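(* Let $\sigma=(\sigma_i)_{i\ge0}\in\{0,1\}^{\mathbb N_0}$ and $h_n=2^{\sum_{i=0}^{n-1}\sigma_i}$, $n\ge1$. Then $(h_n)$ is a scaling sequence of the dyadic filtration $\zeta=(\zeta_n)_{n\ge0}$ on $(I^{\mathcal D}\times I^{\mathbb N},\omega^\sigma)$, and also of the tail filtration $\xi=(\xi_n)_{n\ge0}$ on $(\mathcal T(\mathrm{OP}),\mu^\sigma)$, which is isomorphic to $\zeta$.
   Context: $I=\{0,1\}$; $\mathcal D=\bigoplus_{i\ge0}\mathbb Z/2\mathbb Z$ with generators $g_0,g_1,\dots$, $\mathcal D_n=\langle g_0,\dots,g_{n-1}\rangle$. $I^{\mathbb N}$ is the group of $0$–$1$ sequences $(\alpha_i)_{i\ge1}$ (addition mod 2) with uniform Bernoulli measure $m$; $\tau(\sum_i\alpha_ig_{i-1})=(\alpha_i)_{i\ge1}$. $\operatorname{diag}(g)(w,\alpha)=(w(\cdot+g),\alpha+\tau(g))$ is a free action on $I^{\mathcal D}\times I^{\mathbb N}$; $\zeta_n$ is the partition into $\operatorname{diag}(\mathcal D_n)$-orbits. Let $\mathcal D^\sigma=\langle g_i:\sigma_i=0\rangle$; $m^\sigma$ is the law on $I^{\mathcal D}$ of a random configuration constant on cosets of $\mathcal D^\sigma$ with independent uniform values on distinct cosets; $\omega^\sigma=m^\sigma\times m$. The graph $\mathrm{OP}$: $\mathrm{OP}_0=I$, $\mathrm{OP}_{n+1}=\mathrm{OP}_n\times\mathrm{OP}_n$, with an index-0 edge from $v_0$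 and an index-1 edge from $v_1$ to each $v=(v_0,v_1)$; $\mathcal T(\mathrm{OP})$ is its space of infinite paths from floor 0; $\xi_n$ is the partition into classes of paths coinciding from floor $n$ on. There is a homeomorphism $\Psi\colon\mathcal T(\mathrm{OP})\to I^{\mathcal D}\times I^{\mathbb N}$ mapping $\xi_n$ to $\zeta_n$ for all $n$ (explicitly: $\Psi[x]=(F[x],\alpha)$ where $\alpha_n$ is the index of the $(n-1)$-th edge of $x$ and $F[x](g)=\Phi[v_n](g+\sum_{i<n}\alpha_{i+1}g_i)$ for $g\in\mathcal D_n$, with $\Phi$ labelling floor-$n$ vertices by configurations on $\mathcal D_n$ recursively via $\Phi[(v_0,v_1)](h)=\Phi[v_0](h)$ on $\mathcal D_n$, $=\Phi[v_1](g_n+h)$ on $\mathcal D_{n+1}\setminus\mathcal D_n$); $\mu^\sigma=\Psi^{-1}_*\omega^\sigma$. A dyadic filtration is a sequence of measurable partitions $\varsigma_0\succ\varsigma_1\succ\dots$ with $\varsigma_0$ the partition into points and each element of $\varsigma_{n+1}$ the union of two elements of $\varsigma_n$. Kantorovich iteration: $\mathcal K_n[\rho](c_1,c_2)=\min_s 2^{-n}\sum_{x\in c_1}\rho(x,s(x))$ for $c_1,c_2\in\varsigma_n$, over bijections $s\colon c_1\to c_2$ mapping, for each $j<n$, elements of $\varsigma_j$ in $c_1$ onto elements of $\varsigma_j$ in $c_2$. $\mathbb H_\varepsilon(Y,\nu,d)$ is the binary logarithm of the least $k$ with a measurable partition $Y_0,\dots,Y_k$, $\nu(Y_0)<\varepsilon$,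 $\operatorname{diam}_dY_j<\varepsilon$ ($j\ge1$). A positive sequence $h$ is a scaling sequence of the filtration $\varsigma$ on $(X,\mu)$ if for some (equivalently every) summable admissible metric $\rho$ (measurable on $X^2$, in $L^1(\mu^2)$, a separable metric on a set of full measure) and all sufficiently small $\varepsilon>0$, $\mathbb H_\varepsilon(X/\varsigma_n,\mu/\varsigma_n,\mathcal K_n[\rho])\asymp h_n$, where $a_n\asymp b_n$ means $0<\liminf a_n/b_n\le\limsup a_n/b_n<\infty$. *)

theory Defs
  imports "HOL-Probability.Probability"
begin

text \<open>A filtration of partitions on a space is represented by its class maps:
  cls n x is the element of the n-th partition containing x.\<close>

definition quot_measure :: "'a measure \<Rightarrow> ('a \<Rightarrow> 'a set) \<Rightarrow> 'a set measure" where
  "quot_measure M c =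
     measure_of (c ` space M)
       {C. C \<subseteq> c ` space M \<and> c -` C \<inter> space M \<in> sets M}
       (\<lambda>C. emeasure M (c -` C \<inter> space M))"

definition kant :: "('a \<Rightarrow> 'a \<Rightarrow> real) \<Rightarrow> (nat \<Rightarrow> 'a \<Rightarrow> 'a set) \<Rightarrow> nat \<Rightarrow> 'a set \<Rightarrow> 'a set \<Rightarrow> real" where
  "kant \<rho> cls n c1 c2 =
     Min {(\<Sum>x\<in>c1. \<rho> x (s x)) / 2 ^ n | s.
            bij_betw s c1 c2 \<and> (\<forall>j<n. \<forall>x\<in>c1. s ` cls j x = cls j (s x))}"

definition eps_entropy :: "real \<Rightarrow> 'b measure \<Rightarrow> ('b \<Rightarrow> 'b \<Rightarrow> real) \<Rightarrow> ereal" where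
  "eps_entropy \<epsilon> N d =
     (let P = (\<lambda>k::nat. \<exists>Y::nat \<Rightarrow> 'b set.
                 (\<forall>j\<le>k. Y j \<in> sets N) \<and> (\<Union>j\<le>k. Y j) = space N \<and>
                 disjoint_family_on Y {..k} \<and>
                 emeasure N (Y 0) < ennreal \<epsilon> \<and>
                 (\<forall>j\<in>{1..k}. (SUP p\<in>Y j \<times> Y j. ereal (d (fst p) (snd p))) < ereal \<epsilon>))
      in if \<exists>k. P k then ereal (log 2 (real (LEAST k. P k))) else \<infinity>)"

definition summable_admissible_metric :: "'a measure \<Rightarrow> ('a \<Rightarrow> 'a \<Rightarrow> real) \<Rightarrow> bool" where
  "summable_admissible_metric M \<rho> \<longleftrightarrow>
     case_prod \<rho> \<in> borel_measurable (M \<Otimes>\<^sub>M M) \<and>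
     integrable (M \<Otimes>\<^sub>M M) (case_prod \<rho>) \<and>
     (\<exists>X'. X' \<in> sets M \<and> emeasure M (space M - X') = 0 \<and>
        (\<forall>x\<in>X'. \<forall>y\<in>X'. (\<rho> x y = 0 \<longleftrightarrow> x = y) \<and> \<rho> x y = \<rho> y x) \<and>
        (\<forall>x\<in>X'. \<forall>y\<in>X'. \<forall>z\<in>X'. \<rho> x z \<le> \<rho> x y + \<rho> y z) \<and>
        (\<exists>S. countable S \<and> S \<subseteq> X' \<and> (\<forall>x\<in>X'. \<forall>e>0. \<exists>s\<in>S. \<rho> x s < e)))"

definition weak_equiv :: "(nat \<Rightarrow> ereal) \<Rightarrow> (nat \<Rightarrow> ereal) \<Rightarrow> bool" where
  "weak_equiv a b \<longleftrightarrow>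
     0 < liminf (\<lambda>n. a n / b n) \<and> limsup (\<lambda>n. a n / b n) < \<infinity>"

definition scaling_sequence :: "'a measure \<Rightarrow> (nat \<Rightarrow> 'a \<Rightarrow> 'a set) \<Rightarrow> (nat \<Rightarrow> real) \<Rightarrow> bool" where
  "scaling_sequence M cls h \<longleftrightarrow>
     (\<forall>n. 0 < h n) \<and>
     (\<exists>\<rho>. summable_admissible_metric M \<rho> \<and>
        (\<exists>\<epsilon>0>0. \<forall>\<epsilon>. 0 < \<epsilon> \<and> \<epsilon> < \<epsilon>0 \<longrightarrow>
           weak_equiv (\<lambda>n. eps_entropy \<epsilon> (quot_measure M (cls n)) (kant \<rho> cls n))
                      (\<lambda>n. ereal (h n))))"

text \<open>The group D (finitely supported 0-1 sequences with generators g_i) is encoded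
  as nat with XOR: g = sum of alpha_i g_i corresponds to the natural number with
  binary digits alpha_i; g_i = 2^i, D_n = {g. g < 2^n}.  The sequence
  (alpha_i)_{i>=1} in I^N is stored 0-based: alpha k is alpha_{k+1}.
  The bit value 1 is True.\<close>

definition coin :: "bool measure" where
  "coin = measure_pmf (bernoulli_pmf (1/2))"

definition bern :: "(nat \<Rightarrow> bool) measure" where
  "bern = PiM UNIV (\<lambda>_. coin)"

text \<open>Coset representative of g modulo D^sigma = <g_i : sigma_i = 0>:
  keep exactly the bits i with sigma_i = 1.\<close>
definition coset_rep :: "(nat \<Rightarrow> nat) \<Rightarrow> nat \<Rightarrow> nat" where
  "coset_rep \<sigma> g = (\<Sum>i\<in>{i. i < g \<and> bit g i \<and> \<sigma> i = 1}. 2 ^ i)"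

text \<open>m^sigma: law of a configuration constant on D^sigma-cosets with independent
  uniform values on distinct cosets.\<close>
definition m_sigma :: "(nat \<Rightarrow> nat) \<Rightarrow> (nat \<Rightarrow> bool) measure" where
  "m_sigma \<sigma> = distr bern bern (\<lambda>u g. u (coset_rep \<sigma> g))"

definition omega :: "(nat \<Rightarrow> nat) \<Rightarrow> ((nat \<Rightarrow> bool) \<times> (nat \<Rightarrow> bool)) measure" where
  "omega \<sigma> = m_sigma \<sigma> \<Otimes>\<^sub>M bern"

definition tau :: "nat \<Rightarrow> nat \<Rightarrow> bool" where
  "tau g = (\<lambda>k. bit g k)"

definition diag :: "nat \<Rightarrow> (nat \<Rightarrow> bool) \<times> (nat \<Rightarrow> bool) \<Rightarrow> (nat \<Rightarrow> bool) \<times> (nat \<Rightarrow> bool)" where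
  "diag g p = (\<lambda>h. fst p (xor h g), \<lambda>k. snd p k \<noteq> tau g k)"

definition zeta :: "nat \<Rightarrow> (nat \<Rightarrow> bool) \<times> (nat \<Rightarrow> bool) \<Rightarrow> ((nat \<Rightarrow> bool) \<times> (nat \<Rightarrow> bool)) set" where
  "zeta n p = {diag g p | g. g < 2 ^ n}"

text \<open>The graph OP: a vertex of floor n (an element of OP_n) is encoded as a bool
  list of length 2^n, the pair (v0,v1) being encoded as v0 @ v1 (floor 0: [i]).
  A path is x :: nat => bool list * bool, where fst (x n) is the floor-n vertex
  and snd (x n) the index of the edge from floor n to floor n+1; an index-0 edge
  goes from v0 and an index-1 edge from v1 to (v0,v1).\<close>
type_synonym op_path = "nat \<Rightarrow> bool list \<times> bool"

definition op_paths :: "op_path set" where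
  "op_paths = {x. \<forall>n. length (fst (x n)) = 2 ^ n \<and>
      fst (x n) = (if snd (x n) then drop (2 ^ n) (fst (x (Suc n)))
                   else take (2 ^ n) (fst (x (Suc n))))}"

definition op_space :: "op_path measure" where
  "op_space = restrict_space (PiM UNIV (\<lambda>_. count_space UNIV)) op_paths"

definition xi :: "nat \<Rightarrow> op_path \<Rightarrow> op_path set" where
  "xi n x = {y \<in> op_paths. \<forall>k\<ge>n. y k = x k}"

text \<open>Phi labels a floor-n vertex by a configuration on D_n; with the encoding above
  the recursion Phi[(v0,v1)](h) = Phi[v0](h) on D_n, = Phi[v1](g_n + h) on
  D_(n+1) \ D_n is exactly list indexing.\<close>
definition Phi :: "bool list \<Rightarrow> nat \<Rightarrow> bool" where
  "Phi v h = v ! h"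

text \<open>Psi[x] = (F[x], alpha), F[x](g) = Phi[v_n](g + sum_(i<n) alpha_(i+1) g_i) for
  g in D_n (here with n = g, since g < 2^g).\<close>
definition Psi :: "op_path \<Rightarrow> (nat \<Rightarrow> bool) \<times> (nat \<Rightarrow> bool)" where
  "Psi x = (\<lambda>g. Phi (fst (x g)) (xor g (\<Sum>i<g. if snd (x i) then 2 ^ i else 0)),
            \<lambda>k. snd (x k))"

definition mu :: "(nat \<Rightarrow> nat) \<Rightarrow> op_path measure" where
  "mu \<sigma> = distr (omega \<sigma>) op_space (inv_into op_paths Psi)"

end

theory Submission
  imports Defs
begin

text \<open>
  Take the metric \<open>\<rho>(p, q) = \<Sum>i. 2\<^sup>-\<^sup>i [p and q differ at i]\<close> and let \<open>s = \<Sum>i<n. \<sigma> i\<close>. Almost every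
  configuration is determined on \<open>D_n\<close> by the word of its \<open>2\<^sup>s\<close> values at coset representatives,
  and this word is uniformly distributed.

  Upper bound: an orbit of \<open>D_n\<close> contains exactly one point whose first \<open>n\<close> digits \<open>\<alpha>\<close> vanish.
  If two orbits have the same word at these points, translation matches them with error at most
  \<open>2 \<sqdot> 2\<^sup>-\<^sup>n\<close>; so \<open>2 ^ 2\<^sup>s\<close> sets suffice for large \<open>n\<close>.

  Lower bound: since \<open>\<rho>(p, q) \<ge> [fst p 0 \<noteq> fst q 0]\<close>, the distance of two orbits is at least the
  normalised Hamming distance of their words minimised over the automorphisms of a binary tree of
  height \<open>s\<close>; levels with \<open>\<sigma> i = 0\<close> do not contribute because both halves carry the same word.
  The generating function \<open>A\<^sub>s(l) = \<Sum>l'. x ^ cost s l l'\<close> satisfies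
  \<open>A\<^sub>s\<^sub>+\<^sub>1(a @ b) \<le> 2 A\<^sub>s(a) A\<^sub>s(b)\<close>, and already \<open>2 A\<^sub>2 \<le> 8 (1 + x)\<^sup>3 < 2 ^ 4\<close>. Hence small balls have
  measure at most \<open>c ^ 2\<^sup>s\<close> with \<open>c < 1\<close>.
\<close>

section \<open>Coset representatives and words\<close>

text \<open>The element of \<open>D_n\<close> that \<open>diag\<close> applies to clear the first
  \<open>n\<close> digits of \<alpha>. In the graph it is the translation between a
  floor-\<open>n\<close> vertex and the configuration of the path.\<close>

definition low :: "nat \<Rightarrow> (nat \<Rightarrow> bool) \<Rightarrow> nat" where
  "low n \<alpha> = (\<Sum>i<n. if \<alpha> i then 2 ^ i else 0)"

lemma low_Suc: "low (Suc n) \<alpha> = low n \<alpha> + (if \<alpha> n then 2 ^ n else 0)"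
  by (simp add: low_def)

lemma low_less: "low n \<alpha> < 2 ^ n"
  by (induction n) (auto simp: low_Suc low_def)

lemma bit_low: "bit (low n \<alpha>) k \<longleftrightarrow> k < n \<and> \<alpha> k"
proof -
  have "low n \<alpha> = horner_sum of_bool 2 (map \<alpha> [0..<n])"
    unfolding low_def horner_sum_eq_sum by (rule sum.cong) (auto simp: lessThan_atLeast0)
  then show ?thesis
    by (auto simp: bit_horner_sum_bit_iff)
qed

lemma bit_less_pow: "g < 2 ^ n \<Longrightarrow> bit g i \<Longrightarrow> i < n" for g :: nat
  by (metis bit_take_bit_iff take_bit_nat_eq_self_iff)

lemma less_pow_iff_bit: "g < 2 ^ n \<longleftrightarrow> (\<forall>i. bit g i \<longrightarrow> i < n)" for g :: nat
proof
  assume "\<forall>i. bit g i \<longrightarrow> i < n"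
  then have "take_bit n g = g"
    by (intro bit_eqI) (auto simp: bit_take_bit_iff)
  then show "g < 2 ^ n"
    by (simp add: take_bit_nat_eq_self_iff)
qed (auto intro: bit_less_pow)

lemma xor_less_pow: "g < 2 ^ n \<Longrightarrow> h < 2 ^ n \<Longrightarrow> xor g h < 2 ^ n" for g h :: nat
  by (auto simp: less_pow_iff_bit bit_xor_iff)

lemma xor_cancel: "xor (xor g h) h = g" for g h :: nat
  by (simp add: xor.assoc)

lemma bit_less_self: "bit g i \<Longrightarrow> i < g" for g :: nat
  by (metis less_exp bit_less_pow)

lemma bit_coset_rep: "bit (coset_rep \<sigma> g) i \<longleftrightarrow> bit g i \<and> \<sigma> i = 1"
proof -
  \<comment> \<open>The bound \<open>i < g\<close> in \<open>coset_rep\<close> loses no digit,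
    because \<open>bit g i\<close> already forces \<open>i < g\<close>.\<close>
  have "coset_rep \<sigma> g = low g (\<lambda>i. bit g i \<and> \<sigma> i = 1)"
    unfolding coset_rep_def low_def
    by (subst sum.inter_filter [symmetric]) (auto intro!: sum.cong)
  then show ?thesis
    by (auto simp: bit_low bit_less_self)
qed

lemma coset_rep_idem: "coset_rep \<sigma> (coset_rep \<sigma> g) = coset_rep \<sigma> g"
  by (rule bit_eqI) (auto simp: bit_coset_rep)

lemma coset_rep_xor: "coset_rep \<sigma> (xor g h) = xor (coset_rep \<sigma> g) (coset_rep \<sigma> h)"
  by (rule bit_eqI) (auto simp: bit_coset_rep bit_xor_iff)

text \<open>The order matters: for \<open>\<sigma> n = 1\<close> the second half is the translate of
  the first by \<open>2 ^ n\<close>, so a word read along the list is a concatenation of two equally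
  long words, the shape on which \<open>cost\<close> recurses. For \<open>\<sigma> n = 0\<close> the
  generator \<open>2 ^ n\<close> creates no new coset.\<close>

primrec reps :: "(nat \<Rightarrow> nat) \<Rightarrow> nat \<Rightarrow> nat list" where
  "reps \<sigma> 0 = [0]"
| "reps \<sigma> (Suc n) =
     (if \<sigma> n = 1 then reps \<sigma> n @ map (\<lambda>h. xor h (2 ^ n)) (reps \<sigma> n) else reps \<sigma> n)"

lemma set_reps: "set (reps \<sigma> n) = {g. g < 2 ^ n \<and> coset_rep \<sigma> g = g}"
proof -
  have char: "coset_rep \<sigma> g = g \<longleftrightarrow> (\<forall>i. bit g i \<longrightarrow> \<sigma> i = 1)" for g
    by (auto simp: bit_eq_iff bit_coset_rep)
  have "g \<in> set (reps \<sigma> n) \<longleftrightarrow> (\<forall>i. bit g i \<longrightarrow> i < n \<and> \<sigma> i = 1)" for g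
  proof (induction n arbitrary: g)
    case 0
    then show ?case by (auto simp: bit_eq_iff)
  next
    case (Suc n)
    show ?case
    proof (cases "\<sigma> n = 1")
      case False
      then show ?thesis
        by (auto simp: Suc.IH less_Suc_eq)
    next
      case True
      have im: "g \<in> (\<lambda>h. xor h (2 ^ n)) ` A \<longleftrightarrow> xor g (2 ^ n) \<in> A" for A :: "nat set"
        by (metis (no_types, lifting) image_iff xor_cancel)
      show ?thesis
      proof (cases "bit g n")
        case True
        with \<open>\<sigma> n = 1\<close> show ?thesis
          by (auto simp: Suc.IH im bit_xor_iff bit_exp_iff less_Suc_eq)
      next
        case False
        with \<open>\<sigma> n = 1\<close> show ?thesis
          by (auto simp: Suc.IH im bit_xor_iff bit_exp_iff less_Suc_eq)
      qed
    qed
  qed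
  then show ?thesis
    by (auto simp: char less_pow_iff_bit)
qed

lemma distinct_reps: "distinct (reps \<sigma> n)"
proof (induction n)
  case (Suc n)
  have "\<not> bit g n" if "g \<in> set (reps \<sigma> n)" for g
    using that bit_less_pow by (fastforce simp: set_reps)
  then have "set (reps \<sigma> n) \<inter> (\<lambda>h. xor h (2 ^ n)) ` set (reps \<sigma> n) = {}"
    using bit_xor_iff [of _ "2 ^ n :: nat" n] by (auto simp: bit_exp_iff)
  moreover have "inj_on (\<lambda>h. xor h (2 ^ n)) A" for A :: "nat set"
    by (metis inj_onI xor_cancel)
  ultimately show ?case
    using Suc by (auto simp: distinct_map)
qed simp

lemma length_reps:
  assumes "\<forall>i. \<sigma> i \<in> {0, 1}"
  shows "length (reps \<sigma> n) = 2 ^ (\<Sum>i<n. \<sigma> i)"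
proof (induction n)
  case (Suc n)
  from assms have "\<sigma> n = 0 \<or> \<sigma> n = 1" by blast
  with Suc show ?case by auto
qed simp

text \<open>The least Hamming distance between two words of length \<open>2 ^ s\<close> up to
  automorphisms of the binary tree whose leaves are the letters.\<close>

primrec cost :: "nat \<Rightarrow> bool list \<Rightarrow> bool list \<Rightarrow> nat" where
  "cost 0 l l' = of_bool (l \<noteq> l')"
| "cost (Suc s) l l' =
    (let a = take (2 ^ s) l; b = drop (2 ^ s) l; a' = take (2 ^ s) l'; b' = drop (2 ^ s) l'
     in min (cost s a a' + cost s b b') (cost s a b' + cost s b a'))"

section \<open>Words of fixed length and the generating function of the cost\<close>

definition words :: "nat \<Rightarrow> bool list set" where
  "words m = {l. length l = m}"

lemma finite_words: "finite (words m)"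
  using finite_lists_length_eq [of "UNIV :: bool set" m] by (simp add: words_def)

lemma card_words: "card (words m) = 2 ^ m"
  using card_lists_length_eq [of "UNIV :: bool set" m] by (simp add: words_def)

lemma sum_words_add:
  fixes f :: "bool list \<Rightarrow> 'a::comm_monoid_add"
  shows "(\<Sum>l\<in>words (m + k). f l) = (\<Sum>a\<in>words m. \<Sum>b\<in>words k. f (a @ b))"
proof -
  have "bij_betw (\<lambda>(a, b). a @ b) (words m \<times> words k) (words (m + k))"
    by (rule bij_betw_byWitness [where f' = "\<lambda>l. (take m l, drop m l)"])
      (auto simp: words_def)
  then have "(\<Sum>l\<in>words (m + k). f l) = (\<Sum>(a, b)\<in>words m \<times> words k. f (a @ b))"
    by (simp add: sum.reindex_bij_betw [symmetric] split_def)
  then show ?thesis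
    by (simp add: sum.cartesian_product)
qed

lemma words_Suc_pow:
  assumes "l \<in> words (2 ^ Suc s)"
  obtains a b where "a \<in> words (2 ^ s)" "b \<in> words (2 ^ s)" "l = a @ b"
  using assms by (intro that [of "take (2 ^ s) l" "drop (2 ^ s) l"]) (auto simp: words_def)

lemma cost_append:
  assumes "a \<in> words (2 ^ s)" "a' \<in> words (2 ^ s)"
  shows "cost (Suc s) (a @ b) (a' @ b') =
    min (cost s a a' + cost s b b') (cost s a b' + cost s b a')"
  using assms by (simp add: words_def Let_def)

text \<open>At \<open>x < 1\<close> nearby words get the larger weights, so a bound on this sum
  bounds the size of small balls, as in Markov's inequality.\<close>

definition gen_cost :: "real \<Rightarrow> nat \<Rightarrow> bool list \<Rightarrow> real" where
  "gen_cost x s l = (\<Sum>l'\<in>words (2 ^ s). x ^ cost s l l')"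

lemma gen_cost_nonneg: "0 \<le> x \<Longrightarrow> 0 \<le> gen_cost x s l"
  unfolding gen_cost_def by (intro sum_nonneg) auto

lemma gen_cost_append:
  assumes "a \<in> words (2 ^ s)"
  shows "gen_cost x (Suc s) (a @ b) = (\<Sum>a'\<in>words (2 ^ s). \<Sum>b'\<in>words (2 ^ s).
    x ^ min (cost s a a' + cost s b b') (cost s a b' + cost s b a'))"
proof -
  have "(2 :: nat) ^ Suc s = 2 ^ s + 2 ^ s" by simp
  then show ?thesis
    unfolding gen_cost_def
    by (simp only: sum_words_add) (intro sum.cong refl, simp only: cost_append [OF assms])
qed

text \<open>A power of a minimum is one of the two powers, hence at most their sum, and both
  resulting double sums factorise. The factor 2 is the price of the swap at the root.\<close>

lemma gen_cost_append_le:
  assumes "a \<in> words (2 ^ s)" "0 \<le> x"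
  shows "gen_cost x (Suc s) (a @ b) \<le> 2 * (gen_cost x s a * gen_cost x s b)"
proof -
  have "gen_cost x (Suc s) (a @ b) \<le> (\<Sum>a'\<in>words (2 ^ s). \<Sum>b'\<in>words (2 ^ s).
      x ^ cost s a a' * x ^ cost s b b' + x ^ cost s a b' * x ^ cost s b a')"
    unfolding gen_cost_append [OF assms(1)]
    by (intro sum_mono) (use assms(2) in \<open>auto simp: min_def power_add\<close>)
  also have "\<dots> = gen_cost x s a * gen_cost x s b + gen_cost x s b * gen_cost x s a"
  proof -
    have "(\<Sum>a'\<in>words (2 ^ s). \<Sum>b'\<in>words (2 ^ s). x ^ cost s a b' * x ^ cost s b a') =
        gen_cost x s b * gen_cost x s a"
      unfolding gen_cost_def sum_product by (intro sum.cong refl mult.commute)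
    then show ?thesis
      unfolding sum.distrib by (simp add: gen_cost_def sum_product)
  qed
  finally show ?thesis by simp
qed

lemma words_1: "words (Suc 0) = {[False], [True]}"
  by (auto simp: words_def length_Suc_conv)

lemma gen_cost_0: "l \<in> words 1 \<Longrightarrow> gen_cost x 0 l = 1 + x"
  by (auto simp: gen_cost_def words_1)

lemma gen_cost_1:
  "gen_cost x 1 [p, q] = (if p = q then (1 + x)\<^sup>2 else 2 * (1 + x))"
proof -
  have "gen_cost x (Suc 0) ([p] @ [q]) = (\<Sum>a'\<in>words (2 ^ 0). \<Sum>b'\<in>words (2 ^ 0).
    x ^ min (cost 0 [p] a' + cost 0 [q] b') (cost 0 [p] b' + cost 0 [q] a'))"
    by (rule gen_cost_append) (simp add: words_def)
  then show ?thesis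
    by (cases p; cases q) (simp_all add: words_1 power2_eq_square algebra_simps)
qed

text \<open>This is where the automorphisms lose against the words: swapping two equivalent
  halves gives nothing new, so that at most two of the three nodes contribute a factor 2.\<close>

lemma gen_cost_2_le:
  assumes "0 \<le> x" "x \<le> 1" "l \<in> words (2 ^ 2)"
  shows "gen_cost x 2 l \<le> 4 * (1 + x) ^ 3"
proof -
  from assms(3) obtain p q r t where l: "l = [p, q, r, t]"
    by (auto simp: words_def eval_nat_numeral length_Suc_conv)
  show ?thesis
  proof (cases "p \<noteq> q \<and> r \<noteq> t")
    \<comment> \<open>Two mixed pairs differ at most by a swap, so they have the same cost to every
      word. The minimum at the root is then between equal numbers and the root contributes no factor
      2.\<close>
    case True
    have "cost 1 [p, q] c = cost 1 [r, t] c" if c: "c \<in> words (Suc (Suc 0))" for c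
    proof -
      obtain u v where "c = [u, v]"
        using c by (auto simp: words_def length_Suc_conv)
      with True show ?thesis
        by (cases p; cases r; simp add: Let_def)
    qed
    then have same: "cost 1 [p, q] c = cost 1 [r, t] c" if "c \<in> words (2 ^ 1)" for c
      using that by (simp only: power_one_right numeral_2_eq_2)
    have "[p, q] \<in> words (2 ^ 1)" by (simp add: words_def)
    then have eq: "gen_cost x (Suc 1) ([p, q] @ [r, t]) = (\<Sum>a'\<in>words (2 ^ 1). \<Sum>b'\<in>words (2 ^ 1).
       x ^ cost 1 [p, q] a' * x ^ cost 1 [r, t] b')"
      unfolding gen_cost_append [OF \<open>[p, q] \<in> words (2 ^ 1)\<close>]
      by (intro sum.cong refl) (simp only: same add.commute min.idem power_add mult.commute)
    have "gen_cost x 2 l = gen_cost x (Suc 1) ([p, q] @ [r, t])"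
      by (simp only: l Suc_1 append.simps)
    also have "\<dots> = gen_cost x 1 [p, q] * gen_cost x 1 [r, t]"
      unfolding eq by (simp only: gen_cost_def sum_product)
    also have "\<dots> = 4 * (1 + x)\<^sup>2"
      using True by (simp only: gen_cost_1) (simp add: power2_eq_square algebra_simps)
    also have "\<dots> \<le> 4 * (1 + x) ^ 3"
      using assms by (intro mult_left_mono power_increasing) auto
    finally show ?thesis .
  next
    case False
    have "gen_cost x 2 l \<le> 2 * (gen_cost x 1 [p, q] * gen_cost x 1 [r, t])"
      using gen_cost_append_le [of "[p, q]" 1 x "[r, t]"] assms(1)
      by (simp only: l Suc_1) (simp add: words_def)
    moreover have "gen_cost x 1 [p, q] * gen_cost x 1 [r, t] \<le> 2 * (1 + x) ^ 3"
    proof -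
      have *: "(1 + x)\<^sup>2 \<le> 2 * (1 + x)"
        using mult_right_mono [of "1 + x" 2 "1 + x"] assms by (simp add: power2_eq_square)
      \<comment> \<open>At least one pair is constant and contributes
        \<open>(1 + x)\<^sup>2\<close>; the other contributes at most \<open>2 * (1 + x)\<close>, by
        the inequality just shown.\<close>
      have "gen_cost x 1 [p, q] * gen_cost x 1 [r, t] \<le> (1 + x)\<^sup>2 * (2 * (1 + x))"
      proof (cases "p = q")
        case True
        then show ?thesis
          unfolding gen_cost_1 using * assms by (auto intro!: mult_left_mono)
      next
        case pq: False
        with False show ?thesis
          unfolding gen_cost_1 by simp
      qed
      then show ?thesis
        by (simp add: power2_eq_square power3_eq_cube algebra_simps)
    qed
    ultimately show ?thesis by simp
  qed
qed

lemma gen_cost_le: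
  assumes "l \<in> words (2 ^ s)"
  shows "gen_cost (1 / 16) s l \<le> (9 / 5) ^ (2 ^ s)"
proof -
  \<comment> \<open>The extra factor 2 absorbs the one in \<open>gen_cost_append_le\<close>, so that
    the bound simply squares from one height to the next. Height 2 is the first at which it holds:
    \<open>8 * (17 / 16) ^ 3 < (9 / 5) ^ 4\<close>.\<close>
  have big: "2 * gen_cost (1 / 16) (s + 2) l \<le> (9 / 5) ^ (2 ^ (s + 2))"
    if "l \<in> words (2 ^ (s + 2))" for s l
    using that
  proof (induction s arbitrary: l)
    case 0
    then have "gen_cost (1 / 16) 2 l \<le> 4 * (1 + 1 / 16) ^ 3"
      by (intro gen_cost_2_le) auto
    then show ?case
      by (simp add: eval_nat_numeral)
  next
    case (Suc s)
    obtain a b where ab: "a \<in> words (2 ^ (s + 2))" "b \<in> words (2 ^ (s + 2))" "l = a @ b"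
      using words_Suc_pow [of l "s + 2"] Suc.prems by auto
    have "gen_cost (1 / 16) (Suc s + 2) l \<le> 2 * (gen_cost (1 / 16) (s + 2) a * gen_cost (1 / 16) (s + 2) b)"
      using gen_cost_append_le [OF ab(1), of "1 / 16" b] ab(3) by simp
    then have "2 * gen_cost (1 / 16) (Suc s + 2) l
        \<le> (2 * gen_cost (1 / 16) (s + 2) a) * (2 * gen_cost (1 / 16) (s + 2) b)"
      by simp
    also have "\<dots> \<le> (9 / 5) ^ (2 ^ (s + 2)) * (9 / 5) ^ (2 ^ (s + 2))"
      by (intro mult_mono Suc.IH ab) (auto intro: gen_cost_nonneg)
    also have "\<dots> = (9 / 5) ^ (2 ^ (Suc s + 2))"
      by (simp flip: power_add)
    finally show ?case .
  qed
  \<comment> \<open>At heights 0 and 1 the strengthened bound fails, but the plain one can be read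
    off the exact values.\<close>
  consider "s = 0" | "s = 1" | t where "s = t + 2"
    by (metis One_nat_def add_2_eq_Suc' not0_implies_Suc)
  then show ?thesis
  proof cases
    case 1
    then show ?thesis using assms by (simp add: gen_cost_0)
  next
    case 2
    with assms obtain p q where "l = [p, q]"
      by (auto simp: words_def eval_nat_numeral length_Suc_conv)
    with 2 show ?thesis
      by (simp only: gen_cost_1) (simp add: power2_eq_square)
  next
    case 3
    with big [of l t] assms have "2 * gen_cost (1 / 16) s l \<le> (9 / 5) ^ (2 ^ s)"
      by simp
    moreover have "0 \<le> gen_cost (1 / 16) s l"
      by (simp add: gen_cost_nonneg)
    ultimately show ?thesis by linarith
  qed
qed

text \<open>Markov's inequality at \<open>x = 1 / 16\<close>: since
  \<open>16 powr (1 / 100) \<le> 21 / 20\<close>, each word of the ball has weight at least 1 after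
  multiplication by \<open>(21 / 20) ^ (2 ^ s)\<close>. The base
  \<open>9 / 5 * 21 / 20 = 189 / 100\<close> stays below 2, the base in the number of all
  words.\<close>

lemma card_cost_ball_le:
  assumes "l \<in> words (2 ^ s)" "\<epsilon> < 1 / 100"
  shows "real (card {l' \<in> words (2 ^ s). real (cost s l l') < \<epsilon> * 2 ^ s}) \<le> (19 / 10) ^ (2 ^ s)"
proof -
  let ?B = "{l' \<in> words (2 ^ s). real (cost s l l') < \<epsilon> * 2 ^ s}"
  have root: "16 powr (1 / 100 :: real) \<le> 21 / 20"
  proof -
    have "(16 :: real) \<le> (21 / 20) ^ 100"
    proof -
      have "(2 :: real) \<le> (21 / 20) ^ 25"
        by (simp add: eval_nat_numeral)
      then have "2 ^ 4 \<le> ((21 / 20 :: real) ^ 25) ^ 4"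
        by (intro power_mono) auto
      then show ?thesis by (simp flip: power_mult)
    qed
    then have "16 powr (1 / 100) \<le> ((21 / 20 :: real) ^ 100) powr (1 / 100)"
      by (intro powr_mono2) auto
    also have "(21 / 20 :: real) ^ 100 = (21 / 20) powr 100"
      using powr_realpow [of "21 / 20" 100] by simp
    also have "((21 / 20 :: real) powr 100) powr (1 / 100) = 21 / 20"
      by (simp only: powr_powr) simp
    finally show ?thesis .
  qed
  have le: "1 \<le> (21 / 20) ^ (2 ^ s) * (1 / 16 :: real) ^ cost s l l'" if "l' \<in> ?B" for l'
  proof -
    have "\<epsilon> * 2 ^ s \<le> 1 / 100 * 2 ^ s"
      using assms(2) by (intro mult_right_mono) auto
    moreover from that have "real (cost s l l') < \<epsilon> * 2 ^ s"
      by blast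
    ultimately have "real (cost s l l') \<le> 1 / 100 * 2 ^ s"
      by linarith
    then have "(16 :: real) ^ cost s l l' \<le> 16 powr (1 / 100 * 2 ^ s)"
      by (subst powr_realpow [symmetric]) (auto intro!: powr_mono)
    also have "\<dots> = (16 powr (1 / 100)) powr real (2 ^ s)"
      by (simp only: powr_powr) simp
    also have "\<dots> = (16 powr (1 / 100)) ^ (2 ^ s)"
      by (rule powr_realpow) simp
    also have "\<dots> \<le> (21 / 20) ^ (2 ^ s)"
      using root by (intro power_mono) auto
    finally show ?thesis
      by (simp add: power_divide field_simps)
  qed
  have "real (card ?B) \<le> (\<Sum>l'\<in>?B. (21 / 20) ^ (2 ^ s) * (1 / 16 :: real) ^ cost s l l')"
    using sum_mono [of ?B "\<lambda>_. 1 :: real", OF le] by simp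
  also have "\<dots> \<le> (\<Sum>l'\<in>words (2 ^ s). (21 / 20) ^ (2 ^ s) * (1 / 16 :: real) ^ cost s l l')"
    by (intro sum_mono2) (auto simp: finite_words)
  also have "\<dots> = (21 / 20) ^ (2 ^ s) * gen_cost (1 / 16) s l"
    by (simp add: gen_cost_def sum_distrib_left)
  also have "\<dots> \<le> (21 / 20) ^ (2 ^ s) * (9 / 5) ^ (2 ^ s)"
    by (intro mult_left_mono gen_cost_le assms) auto
  also have "\<dots> = (189 / 100) ^ (2 ^ s)"
    by (simp flip: power_mult_distrib)
  also have "\<dots> \<le> (19 / 10) ^ (2 ^ s)"
    by (intro power_mono) auto
  finally show ?thesis .
qed

section \<open>The measures and the metric\<close>

lemma prob_space_coin: "prob_space coin"
  unfolding coin_def by (rule measure_pmf.prob_space_axioms)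

lemma sets_coin [measurable_cong]: "sets coin = sets (count_space UNIV)"
  by (simp add: coin_def)

lemma space_coin: "space coin = UNIV"
  by (simp add: coin_def)

lemma emeasure_coin: "emeasure coin {b} = ennreal (1 / 2)"
  unfolding coin_def
  by (cases b) (simp_all add: emeasure_pmf_single)

lemma space_bern: "space bern = UNIV"
  by (simp add: bern_def space_PiM space_coin PiE_def)

lemma prob_space_bern: "prob_space bern"
  unfolding bern_def by (intro prob_space_PiM prob_space_coin)

lemma measurable_bern_component [measurable]: "(\<lambda>u. u i) \<in> measurable bern (count_space UNIV)"
proof -
  have "(\<lambda>u. u i) \<in> measurable bern coin"
    unfolding bern_def by (rule measurable_component_singleton) simp
  then show ?thesis
    by (subst (asm) measurable_cong_sets [OF refl sets_coin])
qed

lemma measurable_into_bern: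
  assumes "\<And>i. (\<lambda>x. f x i) \<in> measurable N (count_space UNIV)"
  shows "f \<in> measurable N bern"
  unfolding bern_def
  by (rule measurable_PiM_single')
    (use assms in \<open>auto simp: space_coin PiE_def measurable_cong_sets [OF refl sets_coin]\<close>)

lemma emeasure_bern_word:
  assumes "distinct ks" "length l = length ks"
  shows "emeasure bern {u. map u ks = l} = ennreal (1 / 2) ^ length ks"
proof -
  interpret product_prob_space "\<lambda>_. coin" UNIV
    by (intro product_prob_space.intro product_prob_space_axioms.intro
        product_sigma_finite.intro prob_space_coin prob_space_imp_sigma_finite)
  \<comment> \<open>As the positions are distinct, the word extends to a function on positions, and
    the event becomes a cylinder over \<open>set ks\<close>.\<close>
  obtain v where v: "l = map v ks"
  proof
    show "l = map (\<lambda>k. the (map_of (zip ks l) k)) ks"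
      using assms by (intro nth_equalityI) (auto simp: map_of_zip_nth)
  qed
  have "{u. map u ks = l} = prod_emb UNIV (\<lambda>_. coin) (set ks) (Pi\<^sub>E (set ks) (\<lambda>k. {v k}))"
    by (auto simp: v prod_emb_def space_coin PiE_def extensional_def restrict_def)
  also have "emeasure bern \<dots> = (\<Prod>k\<in>set ks. emeasure coin {v k})"
    unfolding bern_def by (rule emeasure_PiM_emb) (auto simp: sets_coin)
  also have "\<dots> = ennreal (1 / 2) ^ length ks"
    using assms(1) by (simp add: emeasure_coin distinct_card)
  finally show ?thesis .
qed

lemma measurable_map_word [measurable]:
  "(\<lambda>u. map u ks) \<in> measurable bern (count_space UNIV)"
  by (induction ks) simp_all

lemma measurable_coset_rep:
  "(\<lambda>u g. u (coset_rep \<sigma> g)) \<in> measurable bern bern"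
  by (rule measurable_into_bern) simp

lemma sets_m_sigma [measurable_cong]: "sets (m_sigma \<sigma>) = sets bern"
  by (simp add: m_sigma_def)

lemma space_m_sigma: "space (m_sigma \<sigma>) = UNIV"
  by (simp add: m_sigma_def space_bern)

lemma prob_space_m_sigma: "prob_space (m_sigma \<sigma>)"
  unfolding m_sigma_def
  by (intro prob_space.prob_space_distr prob_space_bern measurable_coset_rep)

text \<open>Elements of \<open>reps\<close> are fixed by \<open>coset_rep\<close>, so the event
  pulls back to a condition on independent coins at distinct positions.\<close>

lemma emeasure_m_sigma_word:
  assumes "length l = length (reps \<sigma> n)"
  shows "emeasure (m_sigma \<sigma>) {w. map w (reps \<sigma> n) = l} = ennreal (1 / 2) ^ length (reps \<sigma> n)"
proof -
  have "{w \<in> space bern. map w (reps \<sigma> n) = l} \<in> sets bern"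
    by measurable
  then have "emeasure (m_sigma \<sigma>) {w. map w (reps \<sigma> n) = l} =
      emeasure bern ((\<lambda>u g. u (coset_rep \<sigma> g)) -` {w. map w (reps \<sigma> n) = l} \<inter> space bern)"
    unfolding m_sigma_def by (intro emeasure_distr measurable_coset_rep) (simp add: space_bern)
  also have "(\<lambda>u g. u (coset_rep \<sigma> g)) -` {w. map w (reps \<sigma> n) = l} \<inter> space bern =
      {u. map u (reps \<sigma> n) = l}"
  proof -
    have "map (\<lambda>g. u (coset_rep \<sigma> g)) (reps \<sigma> n) = map u (reps \<sigma> n)" for u :: "nat \<Rightarrow> bool"
      by (simp add: set_reps)
    then show ?thesis
      by (simp only: vimage_def mem_Collect_eq space_bern Int_UNIV_right)
  qed
  also have "emeasure bern \<dots> = ennreal (1 / 2) ^ length (reps \<sigma> n)"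
    by (intro emeasure_bern_word distinct_reps assms)
  finally show ?thesis .
qed

text \<open>Constancy on the cosets of \<open>D^\<sigma>\<close>, as two elements lie in one coset
  exactly when \<open>coset_rep\<close> agrees on them. Stated by countably many equations, which
  gives measurability.\<close>

definition periodic :: "(nat \<Rightarrow> nat) \<Rightarrow> (nat \<Rightarrow> bool) set" where
  "periodic \<sigma> = {w. \<forall>g. w g = w (coset_rep \<sigma> g)}"

lemma periodic_sets: "periodic \<sigma> \<in> sets bern"
proof -
  have "{w \<in> space bern. \<forall>g. w g = w (coset_rep \<sigma> g)} \<in> sets bern"
    by measurable
  then show ?thesis
    by (simp add: space_bern periodic_def)
qed

text \<open>The map defining \<open>m_sigma\<close> takes only periodic values, because
  \<open>coset_rep\<close> is idempotent.\<close>

lemma emeasure_not_periodic: "emeasure (m_sigma \<sigma>) (- periodic \<sigma>) = 0"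
proof -
  have "emeasure (m_sigma \<sigma>) (- periodic \<sigma>) =
      emeasure bern ((\<lambda>u g. u (coset_rep \<sigma> g)) -` (- periodic \<sigma>) \<inter> space bern)"
    unfolding m_sigma_def using sets.compl_sets [OF periodic_sets [of \<sigma>]]
    by (intro emeasure_distr measurable_coset_rep) (simp add: space_bern Compl_eq_Diff_UNIV)
  also have "(\<lambda>u g. u (coset_rep \<sigma> g)) -` (- periodic \<sigma>) = {}"
    by (auto simp: periodic_def coset_rep_idem)
  finally show ?thesis by simp
qed

lemma sets_omega [measurable_cong]: "sets (omega \<sigma>) = sets (bern \<Otimes>\<^sub>M bern)"
  unfolding omega_def by (intro sets_pair_measure_cong sets_m_sigma refl)

lemma space_omega: "space (omega \<sigma>) = UNIV"
  by (simp add: omega_def space_pair_measure space_m_sigma space_bern)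

lemma prob_space_omega: "prob_space (omega \<sigma>)"
proof -
  interpret pair_prob_space "m_sigma \<sigma>" bern
    by (intro pair_prob_space.intro pair_sigma_finite.intro prob_space_imp_sigma_finite
        prob_space_m_sigma prob_space_bern)
  show ?thesis
    unfolding omega_def by (rule prob_space_axioms)
qed

lemma emeasure_omega_fst:
  assumes "A \<in> sets bern"
  shows "emeasure (omega \<sigma>) {p. fst p \<in> A} = emeasure (m_sigma \<sigma>) A"
proof -
  interpret B: prob_space bern by (rule prob_space_bern)
  have "{p :: (nat \<Rightarrow> bool) \<times> (nat \<Rightarrow> bool). fst p \<in> A} = A \<times> space bern"
    by (auto simp: space_bern)
  then show ?thesis
    using B.emeasure_pair_measure_Times [of A "m_sigma \<sigma>" "space bern"] assms
    by (simp add: omega_def sets_m_sigma B.emeasure_space_1)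
qed

lemma measurable_word [measurable]:
  "(\<lambda>p. map (fst p) ks) \<in> measurable (omega \<sigma>) (count_space UNIV)"
  by measurable

lemma emeasure_omega_words_le:
  assumes "B \<subseteq> words (length (reps \<sigma> n))"
  shows "emeasure (omega \<sigma>) {p. map (fst p) (reps \<sigma> n) \<in> B} \<le>
    ennreal (real (card B) / 2 ^ length (reps \<sigma> n))"
proof -
  let ?W = "\<lambda>l. {w. map w (reps \<sigma> n) = l}"
  have fin: "finite B"
    using assms finite_words finite_subset by blast
  have W: "?W l \<in> sets bern" for l
  proof -
    have "{w \<in> space bern. map w (reps \<sigma> n) = l} \<in> sets bern" by measurable
    then show ?thesis by (simp add: space_bern)
  qed
  have "{p. map (fst p) (reps \<sigma> n) \<in> B} = {p :: _ \<times> (nat \<Rightarrow> bool). fst p \<in> (\<Union>l\<in>B. ?W l)}"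
    by auto
  then have "emeasure (omega \<sigma>) {p. map (fst p) (reps \<sigma> n) \<in> B} =
      emeasure (m_sigma \<sigma>) (\<Union>l\<in>B. ?W l)"
    using emeasure_omega_fst [of "\<Union>l\<in>B. ?W l" \<sigma>] W fin by auto
  also have "\<dots> \<le> (\<Sum>l\<in>B. emeasure (m_sigma \<sigma>) (?W l))"
    by (intro emeasure_subadditive_finite fin) (use W in \<open>auto simp: sets_m_sigma\<close>)
  also have "\<dots> = (\<Sum>l\<in>B. ennreal (1 / 2) ^ length (reps \<sigma> n))"
    using assms by (intro sum.cong refl emeasure_m_sigma_word) (auto simp: words_def)
  also have "\<dots> = ennreal (real (card B) / 2 ^ length (reps \<sigma> n))"
  proof -
    have "ennreal (1 / 2) ^ m = ennreal ((1 / 2) ^ m)" for m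
      by (rule ennreal_power) simp
    then show ?thesis
      by (simp add: power_divide ennreal_of_nat_eq_real_of_nat flip: ennreal_mult)
  qed
  finally show ?thesis .
qed

section \<open>A metric on pairs of 0-1 sequences\<close>

definition differ :: "(nat \<Rightarrow> bool) \<times> (nat \<Rightarrow> bool) \<Rightarrow> (nat \<Rightarrow> bool) \<times> (nat \<Rightarrow> bool) \<Rightarrow> nat \<Rightarrow> bool" where
  "differ p q i \<longleftrightarrow> fst p i \<noteq> fst q i \<or> snd p i \<noteq> snd q i"

text \<open>A weighted Hamming metric. The index is a group element in the first coordinate and a
  digit position in the second.\<close>

definition config_dist :: "(nat \<Rightarrow> bool) \<times> (nat \<Rightarrow> bool) \<Rightarrow> (nat \<Rightarrow> bool) \<times> (nat \<Rightarrow> bool) \<Rightarrow> real" where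
  "config_dist p q = (\<Sum>i. (1 / 2) ^ i * of_bool (differ p q i))"

lemma summable_config_dist: "summable (\<lambda>i. (1 / 2 :: real) ^ i * of_bool (P i))"
  by (rule summable_comparison_test' [OF summable_geometric [of "1 / 2 :: real"], where N = 0]) auto

lemma config_dist_ge_0: "0 \<le> config_dist p q"
  unfolding config_dist_def by (intro suminf_nonneg summable_config_dist) auto

lemma config_dist_sym: "config_dist p q = config_dist q p"
  unfolding config_dist_def differ_def by (auto intro!: arg_cong [where f = suminf])

lemma config_dist_eq_0_iff: "config_dist p q = 0 \<longleftrightarrow> p = q"
proof -
  have "config_dist p q = 0 \<longleftrightarrow> (\<forall>i. \<not> differ p q i)"
    unfolding config_dist_def
    by (subst suminf_eq_zero_iff [OF summable_config_dist]) auto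
  also have "\<dots> \<longleftrightarrow> p = q"
    by (auto simp: differ_def prod_eq_iff)
  finally show ?thesis .
qed

lemma config_dist_triangle: "config_dist p r \<le> config_dist p q + config_dist q r"
  unfolding config_dist_def
  by (subst suminf_add [OF summable_config_dist summable_config_dist])
    (intro suminf_le summable_add summable_config_dist, auto simp: differ_def)

text \<open>The term at index 0 has weight 1. Through this property the metric enters the lower
  entropy bound.\<close>

lemma config_dist_ge: "of_bool (fst p 0 \<noteq> fst q 0) \<le> config_dist p q"
proof -
  have "(\<Sum>i\<in>{0}. (1 / 2 :: real) ^ i * of_bool (differ p q i)) \<le> config_dist p q"
    unfolding config_dist_def by (intro sum_le_suminf summable_config_dist) auto
  then show ?thesis
    by (auto simp: differ_def config_dist_ge_0)
qed

text \<open>The tail of a geometric series. With \<open>n = 0\<close> it gives the global bound 2,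
  hence integrability.\<close>

lemma config_dist_le:
  assumes "\<And>i. i < n \<Longrightarrow> \<not> differ p q i"
  shows "config_dist p q \<le> 2 * (1 / 2) ^ n"
proof -
  have "(\<lambda>i. (1 / 2 :: real) ^ n * (1 / 2) ^ i) sums ((1 / 2) ^ n * (1 / (1 - 1 / 2)))"
    by (intro sums_mult geometric_sums) simp
  then have s: "(\<lambda>i. (1 / 2 :: real) ^ (i + n)) sums (2 * (1 / 2) ^ n)"
    by (simp add: power_add mult.commute)
  have "config_dist p q = (\<Sum>i. (1 / 2) ^ (i + n) * of_bool (differ p q (i + n)))"
    unfolding config_dist_def
    by (subst suminf_split_initial_segment [OF summable_config_dist, where k = n]) (simp add: assms)
  also have "\<dots> \<le> (\<Sum>i. (1 / 2) ^ (i + n))"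
    by (rule suminf_le)
      (use s summable_ignore_initial_segment [OF summable_config_dist, where k = n] in
        \<open>auto simp: sums_iff\<close>)
  also have "\<dots> = 2 * (1 / 2) ^ n"
    using s by (simp add: sums_iff)
  finally show ?thesis .
qed

text \<open>Pairs of finitely supported sequences form a countable set, parametrised by
  \<open>bit\<close>; truncating both coordinates after \<open>n\<close> digits approximates any
  point.\<close>

lemma config_dist_dense:
  assumes "0 < e"
  shows "\<exists>s\<in>range (\<lambda>(a :: nat, b :: nat). (bit a, bit b)). config_dist p s < e"
proof -
  obtain n where n: "(1 / 2 :: real) ^ n < e / 2"
    using real_arch_pow_inv [of "e / 2" "1 / 2"] assms by auto
  let ?s = "(bit (low n (fst p)), bit (low n (snd p)))"
  have "config_dist p ?s \<le> 2 * (1 / 2) ^ n"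
    by (intro config_dist_le) (auto simp: differ_def bit_low)
  with n have "config_dist p ?s < e" by linarith
  moreover have "?s \<in> range (\<lambda>(a :: nat, b :: nat). (bit a, bit b))"
    by (rule image_eqI [of _ _ "(low n (fst p), low n (snd p))"]) auto
  ultimately show ?thesis by blast
qed

lemma measurable_config_dist:
  "case_prod config_dist \<in> borel_measurable (omega \<sigma> \<Otimes>\<^sub>M omega \<sigma>)"
  unfolding config_dist_def differ_def case_prod_beta by measurable

section \<open>Entropy and the Kantorovich iteration\<close>

text \<open>Preimages commute with complements and countable unions, so the family in
  \<open>quot_measure\<close> is already a sigma-algebra and generation adds no sets.\<close>

lemma
  shows space_quot_measure: "space (quot_measure M c) = c ` space M"
    and sets_quot_measure:
      "sets (quot_measure M c) = {C. C \<subseteq> c ` space M \<and> c -` C \<inter> space M \<in> sets M}"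
proof -
  let ?A = "{C. C \<subseteq> c ` space M \<and> c -` C \<inter> space M \<in> sets M}"
  have A: "?A \<subseteq> Pow (c ` space M)" by auto
  have "sigma_algebra (c ` space M) ?A"
  proof (unfold sigma_algebra_iff2, intro conjI ballI allI impI)
    fix C assume "C \<in> ?A"
    moreover have "c -` (c ` space M - C) \<inter> space M = space M - (c -` C \<inter> space M)" by auto
    ultimately show "c ` space M - C \<in> ?A" by auto
  next
    fix C :: "nat \<Rightarrow> _" assume "range C \<subseteq> ?A"
    then have "(\<Union>i. c -` C i \<inter> space M) \<in> sets M" "(\<Union>i. C i) \<subseteq> c ` space M"
      by (intro sets.countable_UN, auto)
    moreover have "c -` (\<Union>i. C i) \<inter> space M = (\<Union>i. c -` C i \<inter> space M)"
      by auto
    ultimately show "(\<Union>i. C i) \<in> ?A"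
      by simp
  qed auto
  then show "sets (quot_measure M c) = ?A"
    unfolding quot_measure_def by (simp add: sets_measure_of [OF A] sigma_algebra.sigma_sets_eq)
  show "space (quot_measure M c) = c ` space M"
    unfolding quot_measure_def by (simp add: space_measure_of [OF A])
qed

lemma emeasure_quot_measure:
  assumes "C \<in> sets (quot_measure M c)"
  shows "emeasure (quot_measure M c) C = emeasure M (c -` C \<inter> space M)"
proof (rule emeasure_measure_of [OF quot_measure_def _ _ _ assms])
  show "countably_additive (sets (quot_measure M c)) (\<lambda>C. emeasure M (c -` C \<inter> space M))"
  proof (rule countably_additiveI)
    fix A :: "nat \<Rightarrow> _" assume A: "range A \<subseteq> sets (quot_measure M c)" "disjoint_family A"
    have "(\<Sum>i. emeasure M (c -` A i \<inter> space M)) = emeasure M (\<Union>i. c -` A i \<inter> space M)"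
      by (rule suminf_emeasure)
        (use A in \<open>auto simp: sets_quot_measure disjoint_family_on_def disjoint_iff\<close>)
    then show "(\<Sum>i. emeasure M (c -` A i \<inter> space M)) = emeasure M (c -` (\<Union>i. A i) \<inter> space M)"
      by (simp add: vimage_UN)
  qed
qed (auto simp: positive_def)

definition eps_partition :: "real \<Rightarrow> 'b measure \<Rightarrow> ('b \<Rightarrow> 'b \<Rightarrow> real) \<Rightarrow> nat \<Rightarrow> (nat \<Rightarrow> 'b set) \<Rightarrow> bool" where
  "eps_partition \<epsilon> N d k Y \<longleftrightarrow>
     (\<forall>j\<le>k. Y j \<in> sets N) \<and> (\<Union>j\<le>k. Y j) = space N \<and>
     disjoint_family_on Y {..k} \<and>
     emeasure N (Y 0) < ennreal \<epsilon> \<and>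
     (\<forall>j\<in>{1..k}. (SUP p\<in>Y j \<times> Y j. ereal (d (fst p) (snd p))) < ereal \<epsilon>)"

lemma eps_entropy_eq:
  "eps_entropy \<epsilon> N d = (if \<exists>k. \<exists>Y. eps_partition \<epsilon> N d k Y
     then ereal (log 2 (real (LEAST k. \<exists>Y. eps_partition \<epsilon> N d k Y))) else \<infinity>)"
  unfolding eps_entropy_def eps_partition_def Let_def ..

lemma eps_entropy_ge:
  assumes "\<And>k Y. eps_partition \<epsilon> N d k Y \<Longrightarrow> c \<le> log 2 (real k)"
  shows "ereal c \<le> eps_entropy \<epsilon> N d"
proof (cases "\<exists>k Y. eps_partition \<epsilon> N d k Y")
  case True
  from LeastI_ex [OF True] assms show ?thesis
    by (auto simp: eps_entropy_eq)
qed (simp add: eps_entropy_eq)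

lemma eps_entropy_le:
  assumes "eps_partition \<epsilon> N d k Y" "0 < k"
  shows "eps_entropy \<epsilon> N d \<le> ereal (log 2 (real k))"
proof -
  let ?m = "LEAST k. \<exists>Y. eps_partition \<epsilon> N d k Y"
  have "?m \<le> k"
    using assms(1) by (intro Least_le) blast
  have "log 2 (real ?m) \<le> log 2 (real k)"
  proof (cases "?m = 0")
    \<comment> \<open>With the exceptional set alone the count is 0; \<open>log 2 0\<close> is 0 by
      convention and still at most \<open>log 2 (real k)\<close>.\<close>
    case True
    then show ?thesis using assms(2) by (simp add: log_def)
  next
    case False
    with \<open>?m \<le> k\<close> show ?thesis by simp
  qed
  then show ?thesis
    using assms(1) by (auto simp: eps_entropy_eq)
qed

lemma weak_equivI:
  fixes h :: "nat \<Rightarrow> real"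
  assumes "0 < c" and "\<And>n. 0 < h n"
    and lower: "\<And>n. ereal (c * h n) \<le> a n"
    and upper: "\<forall>\<^sub>F n in sequentially. a n \<le> ereal (h n)"
  shows "weak_equiv a (\<lambda>n. ereal (h n))"
proof -
  have "\<forall>\<^sub>F n in sequentially. ereal c \<le> a n / ereal (h n) \<and> a n / ereal (h n) \<le> 1"
    using upper
  proof eventually_elim
    case (elim n)
    \<comment> \<open>Both bounds together force a finite value, so the quotient is one of real
      numbers.\<close>
    with lower [of n] obtain r where "a n = ereal r"
      by (cases "a n") auto
    with elim lower [of n] \<open>0 < h n\<close> show ?case
      by (auto simp: field_simps)
  qed
  then have "ereal c \<le> liminf (\<lambda>n. a n / ereal (h n))" "limsup (\<lambda>n. a n / ereal (h n)) \<le> 1"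
    by (auto intro!: Liminf_bounded Limsup_bounded elim: eventually_mono)
  moreover have "0 < ereal c" "1 < (\<infinity> :: ereal)"
    using \<open>0 < c\<close> by auto
  ultimately show ?thesis
    unfolding weak_equiv_def using less_le_trans le_less_trans by blast
qed

section \<open>Tree-preserving bijections between classes\<close>

definition tree_map :: "(nat \<Rightarrow> 'a \<Rightarrow> 'a set) \<Rightarrow> nat \<Rightarrow> 'a set \<Rightarrow> 'a set \<Rightarrow> ('a \<Rightarrow> 'a) \<Rightarrow> bool" where
  "tree_map cls n c1 c2 s \<longleftrightarrow>
     bij_betw s c1 c2 \<and> (\<forall>j<n. \<forall>x\<in>c1. s ` cls j x = cls j (s x))"

text \<open>The maps \<open>s\<close> are total, so there may be infinitely many, but the sum
  depends only on their restriction to the finite class. This makes \<open>Min\<close> meaningful in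
  \<open>kant\<close>.\<close>

lemma finite_kant_values:
  assumes "finite c1" "finite c2"
  shows "finite {(\<Sum>x\<in>c1. \<rho> x (s x)) / 2 ^ n | s. tree_map cls n c1 c2 s}" (is "finite ?V")
proof (rule finite_subset)
  show "?V \<subseteq> (\<lambda>s. (\<Sum>x\<in>c1. \<rho> x (s x)) / 2 ^ n) ` (c1 \<rightarrow>\<^sub>E c2)"
  proof
    fix v assume "v \<in> ?V"
    then obtain s where s: "tree_map cls n c1 c2 s" and v: "v = (\<Sum>x\<in>c1. \<rho> x (s x)) / 2 ^ n"
      by blast
    have "v = (\<Sum>x\<in>c1. \<rho> x (restrict s c1 x)) / 2 ^ n"
      unfolding v by (intro arg_cong2 [where f = "(/)"] sum.cong) auto
    moreover have "restrict s c1 \<in> c1 \<rightarrow>\<^sub>E c2"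
      using s by (auto simp: tree_map_def bij_betw_def)
    ultimately show "v \<in> (\<lambda>s. (\<Sum>x\<in>c1. \<rho> x (s x)) / 2 ^ n) ` (c1 \<rightarrow>\<^sub>E c2)"
      by blast
  qed
qed (use assms in \<open>auto intro: finite_PiE\<close>)

lemma kant_le:
  assumes "finite c1" "finite c2" "tree_map cls n c1 c2 s"
  shows "kant \<rho> cls n c1 c2 \<le> (\<Sum>x\<in>c1. \<rho> x (s x)) / 2 ^ n"
  unfolding kant_def tree_map_def [symmetric]
  by (rule Min_le [OF finite_kant_values]) (use assms in auto)

lemma kant_attained:
  assumes "finite c1" "finite c2" "tree_map cls n c1 c2 s"
  obtains s' where "tree_map cls n c1 c2 s'" "kant \<rho> cls n c1 c2 = (\<Sum>x\<in>c1. \<rho> x (s' x)) / 2 ^ n"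
proof -
  let ?V = "{(\<Sum>x\<in>c1. \<rho> x (s x)) / 2 ^ n | s. tree_map cls n c1 c2 s}"
  have "Min ?V \<in> ?V"
    by (rule Min_in [OF finite_kant_values]) (use assms in auto)
  then show ?thesis
    using that unfolding kant_def tree_map_def [symmetric] by blast
qed

section \<open>The orbit action in digits, and measurability of shifted words\<close>

lemma diag_diag: "diag g (diag h p) = diag (xor g h) p"
  by (auto simp: diag_def tau_def bit_xor_iff ac_simps)

lemma diag_0: "diag 0 p = p"
  by (simp add: diag_def tau_def)

lemma periodic_diag: "w \<in> periodic \<sigma> \<Longrightarrow> (\<lambda>h. w (xor h g)) \<in> periodic \<sigma>"
proof (unfold periodic_def, intro CollectI allI)
  fix h assume "w \<in> {w. \<forall>g. w g = w (coset_rep \<sigma> g)}"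
  then have w: "w k = w (coset_rep \<sigma> k)" for k by blast
  have "coset_rep \<sigma> (xor h g) = coset_rep \<sigma> (xor (coset_rep \<sigma> h) g)"
    by (simp add: coset_rep_xor coset_rep_idem)
  then show "w (xor h g) = w (xor (coset_rep \<sigma> h) g)"
    using w [of "xor h g"] w [of "xor (coset_rep \<sigma> h) g"] by simp
qed

lemma low_bit: "g < 2 ^ n \<Longrightarrow> low n (bit g) = g"
  by (rule bit_eqI) (auto simp: bit_low dest: bit_less_pow)

text \<open>A shift by \<open>g\<close> and the change it causes in the clearing element cancel.
  This makes the point with cleared digits an invariant of the orbit.\<close>

lemma low_shift: "g < 2 ^ n \<Longrightarrow> xor (low n (\<lambda>i. \<alpha> i \<noteq> bit g i)) g = low n \<alpha>"
  by (rule bit_eqI) (auto simp: bit_low bit_xor_iff dest: bit_less_pow)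

lemma measurable_low:
  "(\<lambda>p. low n (snd p)) \<in> measurable (omega \<sigma>) (count_space UNIV)"
proof (induction n)
  case 0
  then show ?case by (simp add: low_def)
next
  case (Suc n)
  note [measurable] = Suc
  show ?case unfolding low_Suc by measurable
qed

lemma measurable_shifted_word:
  "(\<lambda>p. map (\<lambda>h. fst p (xor h (low n (snd p)))) ks) \<in> measurable (omega \<sigma>) (count_space UNIV)"
\<comment> \<open>The translation depends on the point but takes countably many values, so it may be
  held fixed.\<close>
proof (rule measurable_compose_countable [OF _ measurable_low])
  fix a
  show "(\<lambda>p. map (\<lambda>h. fst p (xor h a)) ks) \<in> measurable (omega \<sigma>) (count_space UNIV)"
    by (induction ks) simp_all
qed

section \<open>Filtrations conjugate to the orbit filtration\<close>

text \<open>A measure-preserving conjugacy to the orbit filtration. Taking \<open>T\<close> to be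
  the identity gives \<open>zeta\<close>, and \<open>Psi\<close> gives \<open>xi\<close>, so the
  entropy bounds are proved once for both.\<close>

locale config_filtration =
  fixes \<sigma> :: "nat \<Rightarrow> nat" and M :: "'a measure"
    and T :: "'a \<Rightarrow> (nat \<Rightarrow> bool) \<times> (nat \<Rightarrow> bool)" and cls :: "nat \<Rightarrow> 'a \<Rightarrow> 'a set"
  assumes \<sigma>: "\<forall>i. \<sigma> i \<in> {0, 1}"
    and bij: "bij_betw T (space M) UNIV"
    and measurable_T [measurable]: "T \<in> measurable M (omega \<sigma>)"
    and distr_T: "distr M (omega \<sigma>) T = omega \<sigma>"
    and cls: "x \<in> space M \<Longrightarrow> cls n x = {y \<in> space M. T y \<in> zeta n (T x)}"
begin

definition act :: "nat \<Rightarrow> 'a \<Rightarrow> 'a" where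
  "act g x = the_inv_into (space M) T (diag g (T x))"

lemma T_eqD: "T x = T y \<Longrightarrow> x \<in> space M \<Longrightarrow> y \<in> space M \<Longrightarrow> x = y"
  using bij by (auto simp: bij_betw_def inj_on_def)

lemma T_act: "T (act g x) = diag g (T x)"
  unfolding act_def using bij by (intro f_the_inv_into_f_bij_betw) auto

lemma act_space [simp]: "act g x \<in> space M"
  unfolding act_def using bij by (metis UNIV_I bij_betw_def subset_refl the_inv_into_into)

lemma fst_T_act: "fst (T (act g x)) h = fst (T x) (xor h g)"
  by (simp add: T_act diag_def)

lemma snd_T_act: "snd (T (act g x)) i \<longleftrightarrow> (snd (T x) i \<noteq> bit g i)"
  by (simp add: T_act diag_def tau_def)

lemma act_act: "act g (act h x) = act (xor g h) x"
  by (rule T_eqD) (simp_all add: T_act diag_diag)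

lemma act_0: "x \<in> space M \<Longrightarrow> act 0 x = x"
  by (rule T_eqD) (simp_all add: T_act diag_0)

text \<open>Freeness is visible in the second coordinate, which changes exactly at the digits of the
  group element.\<close>

lemma act_eqD:
  assumes "act g x = act h x"
  shows "g = h"
proof (rule bit_eqI)
  show "bit g i = bit h i" for i
    using snd_T_act [of g x i] snd_T_act [of h x i] assms by auto
qed

lemma cls_eq: "x \<in> space M \<Longrightarrow> cls n x = (\<lambda>g. act g x) ` {..<2 ^ n}"
proof -
  assume x: "x \<in> space M"
  have "y \<in> (\<lambda>g. act g x) ` {..<2 ^ n}" if "y \<in> space M" "T y = diag g (T x)" "g < 2 ^ n" for y g
  proof -
    have "y = act g x" using that by (intro T_eqD) (simp_all add: T_act)
    with that show ?thesis by blast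
  qed
  then show ?thesis
    using x by (auto simp: cls zeta_def T_act)
qed

lemma finite_cls: "x \<in> space M \<Longrightarrow> finite (cls n x)"
  by (simp add: cls_eq)

lemma card_cls: "x \<in> space M \<Longrightarrow> card (cls n x) = 2 ^ n"
  by (auto simp: cls_eq intro!: card_image [THEN trans] inj_onI dest: act_eqD)

lemma self_in_cls: "x \<in> space M \<Longrightarrow> x \<in> cls n x"
  unfolding cls_eq by (rule image_eqI [of _ _ 0]) (simp_all add: act_0)

lemma cls_act:
  assumes "x \<in> space M" "g < 2 ^ n"
  shows "cls n (act g x) = cls n x"
proof -
  have "(\<lambda>h. xor h g) ` {..<2 ^ n} = {..<2 ^ n}"
    using assms(2) by (auto simp: xor_less_pow intro!: image_eqI [of _ _ "xor _ g"] simp: xor_cancel)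
  moreover have "(\<lambda>h. act (xor h g) x) ` {..<2 ^ n} = (\<lambda>h. act h x) ` (\<lambda>h. xor h g) ` {..<2 ^ n}"
    by (simp only: image_image)
  ultimately show ?thesis
    using assms(1) by (simp add: cls_eq act_act)
qed

lemma cls_eqI: "x \<in> space M \<Longrightarrow> y \<in> cls n x \<Longrightarrow> cls n y = cls n x"
  using cls_act by (auto simp: cls_eq)

text \<open>Bit \<open>n\<close> decides whether an element of \<open>D_(n+1)\<close> lies in
  \<open>D_n\<close> or in its translate by \<open>2 ^ n\<close>; freeness keeps the two orbits
  disjoint.\<close>

lemma cls_Suc:
  assumes "x \<in> space M"
  shows "cls (Suc n) x = cls n x \<union> cls n (act (2 ^ n) x)"
    and "cls n x \<inter> cls n (act (2 ^ n) x) = {}"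
proof -
  have low: "xor g (2 ^ n) < 2 ^ n" if "g < 2 ^ Suc n" "bit g n" for g :: nat
    using that bit_less_pow [of g "Suc n"]
    by (auto simp: less_pow_iff_bit [of _ n] bit_xor_iff bit_exp_iff less_Suc_eq)
  have high: "xor g (2 ^ n) < 2 ^ Suc n" if "g < 2 ^ n" for g :: nat
    using that by (intro xor_less_pow) auto
  have "g < 2 ^ n" if "g < 2 ^ Suc n" "\<not> bit g n" for g :: nat
    using that bit_less_pow [of g "Suc n"] by (auto simp: less_pow_iff_bit [of _ n] less_Suc_eq)
  then have "{..<2 ^ Suc n} = {..<2 ^ n} \<union> (\<lambda>h. xor h (2 ^ n)) ` {..<2 ^ n :: nat}"
    using low high by (auto simp: image_iff) (metis lessThan_iff xor_cancel)
  then show "cls (Suc n) x = cls n x \<union> cls n (act (2 ^ n) x)"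
    using assms by (simp add: cls_eq act_act image_Un image_image)
  show "cls n x \<inter> cls n (act (2 ^ n) x) = {}"
  proof -
    have False if "g < 2 ^ n" "h < 2 ^ n" "g = xor h (2 ^ n)" for g h :: nat
      using that bit_less_pow [of g n n] bit_less_pow [of h n n]
      by (auto simp: bit_xor_iff bit_exp_iff)
    then show ?thesis
      using assms by (auto simp: cls_eq act_act dest!: act_eqD)
  qed
qed

section \<open>Words of points and the cost of a tree-preserving bijection\<close>

definition word :: "nat \<Rightarrow> 'a \<Rightarrow> bool list" where
  "word n x = map (fst (T x)) (reps \<sigma> n)"

lemma word_in_words: "word n x \<in> words (2 ^ (\<Sum>i<n. \<sigma> i))"
  by (simp add: word_def words_def length_reps [OF \<sigma>])

text \<open>For \<open>\<sigma> n = 0\<close> the generator \<open>2 ^ n\<close> lies in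
  \<open>D^\<sigma>\<close> and leaves a periodic configuration unchanged; otherwise
  \<open>reps\<close> doubles.\<close>

lemma word_Suc:
  assumes "fst (T x) \<in> periodic \<sigma>"
  shows "\<sigma> n = 1 \<Longrightarrow> word (Suc n) x = word n x @ word n (act (2 ^ n) x)"
    and "\<sigma> n = 0 \<Longrightarrow> word (Suc n) x = word n x"
    and "\<sigma> n = 0 \<Longrightarrow> word n (act (2 ^ n) x) = word n x"
proof -
  assume "\<sigma> n = 0"
  then have "coset_rep \<sigma> (xor h (2 ^ n)) = coset_rep \<sigma> h" for h
    by (intro bit_eqI) (auto simp: bit_coset_rep bit_xor_iff bit_exp_iff)
  then have "fst (T x) (xor h (2 ^ n)) = fst (T x) h" for h
    using assms unfolding periodic_def mem_Collect_eq by (metis (no_types))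
  then show "word n (act (2 ^ n) x) = word n x"
    by (simp add: word_def fst_T_act)
qed (simp_all add: word_def fst_T_act)

lemma periodic_act: "fst (T x) \<in> periodic \<sigma> \<Longrightarrow> fst (T (act g x)) \<in> periodic \<sigma>"
  using periodic_diag by (simp add: T_act diag_def)

lemma tree_map_mono:
  assumes "tree_map cls (Suc n) c1 c2 s" "c \<subseteq> c1" "s ` c = c'"
  shows "tree_map cls n c c' s"
  using assms unfolding tree_map_def bij_betw_def
  by (intro conjI allI impI ballI) (auto intro: inj_on_subset simp: subset_iff)

text \<open>Cleared of denominators, this compares normalised distances. A tree map keeps or swaps
  the two halves of a class, and induction applies to each half. For \<open>\<sigma> n = 1\<close>
  the two options are those in the recursion of \<open>cost\<close>. For
  \<open>\<sigma> n = 0\<close> both halves carry the same word, so either option costs twice the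
  old cost while the class doubles in size.\<close>

lemma cost_le_tree_map:
  assumes "x \<in> space M" "y \<in> space M" "fst (T x) \<in> periodic \<sigma>" "fst (T y) \<in> periodic \<sigma>"
    and "tree_map cls n (cls n x) (cls n y) s"
  shows "2 ^ n * cost (\<Sum>i<n. \<sigma> i) (word n x) (word n y)
    \<le> 2 ^ (\<Sum>i<n. \<sigma> i) * (\<Sum>z\<in>cls n x. of_bool (fst (T z) 0 \<noteq> fst (T (s z)) 0))"
  using assms
proof (induction n arbitrary: x y)
  case 0
  have "cls 0 v = {v}" if "v \<in> space M" for v
    using that by (simp add: cls_eq act_0 lessThan_Suc)
  with 0 show ?case
    by (auto simp: tree_map_def bij_betw_def word_def)
next
  case (Suc n)
  define x' y' where "x' = act (2 ^ n) x" and "y' = act (2 ^ n) y"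
  let ?S = "\<lambda>A. \<Sum>z\<in>A. of_bool (fst (T z) 0 \<noteq> fst (T (s z)) 0) :: nat"
  let ?k = "\<Sum>i<n. \<sigma> i"
  note cls_x = cls_Suc [OF Suc.prems(1), of n, folded x'_def]
  note cls_y = cls_Suc [OF Suc.prems(2), of n, folded y'_def]
  have [simp]: "x' \<in> space M" "y' \<in> space M"
    by (simp_all add: x'_def y'_def)
  have per: "fst (T x') \<in> periodic \<sigma>" "fst (T y') \<in> periodic \<sigma>"
    using Suc.prems by (simp_all add: x'_def y'_def periodic_act)
  have sum_split: "?S (cls (Suc n) x) = ?S (cls n x) + ?S (cls n x')"
    unfolding cls_x(1) by (intro sum.union_disjoint cls_x(2) finite_cls) (use Suc.prems in auto)
  have s: "inj_on s (cls (Suc n) x)" "s ` cls (Suc n) x = cls (Suc n) y"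
    and img: "\<And>z. z \<in> cls (Suc n) x \<Longrightarrow> s ` cls n z = cls n (s z)"
    using Suc.prems(5) by (auto simp: tree_map_def bij_betw_def)
  have s_disj: "s ` cls n x \<inter> s ` cls n x' = {}" "s ` cls n x \<union> s ` cls n x' = cls (Suc n) y"
    using s cls_x by (auto simp: image_Un simp flip: inj_on_image_Int)
  have s': "s ` cls n x' = cls (Suc n) y - s ` cls n x"
    using s_disj by blast
  have y': "cls n y' = cls (Suc n) y - cls n y" and y: "cls n y = cls (Suc n) y - cls n y'"
    using cls_y by blast+
  have halves: "2 ^ n * (cost ?k (word n x) (word n u) + cost ?k (word n x') (word n v))
      \<le> 2 ^ ?k * ?S (cls (Suc n) x)"
    if "u \<in> space M" "v \<in> space M" "fst (T u) \<in> periodic \<sigma>" "fst (T v) \<in> periodic \<sigma>"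
      "s ` cls n x = cls n u" "s ` cls n x' = cls n v" for u v
  proof -
    have "2 ^ n * cost ?k (word n x) (word n u) \<le> 2 ^ ?k * ?S (cls n x)"
      using that Suc.prems cls_x(1) by (intro Suc.IH tree_map_mono [OF Suc.prems(5)]) auto
    moreover have "2 ^ n * cost ?k (word n x') (word n v) \<le> 2 ^ ?k * ?S (cls n x')"
      using that per cls_x(1) by (intro Suc.IH tree_map_mono [OF Suc.prems(5)]) auto
    ultimately show ?thesis
      unfolding sum_split distrib_left by (rule add_mono)
  qed
  have "x \<in> cls (Suc n) x"
    using Suc.prems by (simp add: self_in_cls)
  then have "s x \<in> cls (Suc n) y" "s ` cls n x = cls n (s x)"
    using s img by auto
  \<comment> \<open>The half containing \<open>x\<close> goes to the half containing
    \<open>s x\<close>; by bijectivity the other half goes to the complement.\<close>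
  then consider "s ` cls n x = cls n y" | "s ` cls n x = cls n y'"
    using cls_eqI [of y "s x" n] cls_eqI [of y' "s x" n] Suc.prems cls_y(1) by auto
  then have "2 ^ n * (cost ?k (word n x) (word n y) + cost ?k (word n x') (word n y'))
        \<le> 2 ^ ?k * ?S (cls (Suc n) x) \<or>
      2 ^ n * (cost ?k (word n x) (word n y') + cost ?k (word n x') (word n y))
        \<le> 2 ^ ?k * ?S (cls (Suc n) x)"
  proof cases
    case 1
    then have "s ` cls n x' = cls n y'" using s' y' by simp
    with 1 show ?thesis using halves [of y y'] Suc.prems per by simp
  next
    case 2
    then have "s ` cls n x' = cls n y" using s' y by simp
    with 2 show ?thesis using halves [of y' y] Suc.prems per by simp
  qed
  then have min: "2 ^ n * min (cost ?k (word n x) (word n y) + cost ?k (word n x') (word n y'))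
      (cost ?k (word n x) (word n y') + cost ?k (word n x') (word n y))
      \<le> 2 ^ ?k * ?S (cls (Suc n) x)"
    by (elim disjE; elim order_trans [rotated]; intro mult_le_mono2; simp)
  show ?case
  proof (cases "\<sigma> n = 1")
    case True
    with min show ?thesis
      using word_Suc(1) [OF Suc.prems(3), of n] word_Suc(1) [OF Suc.prems(4), of n]
      by (simp add: cost_append word_in_words flip: x'_def y'_def del: cost.simps)
  next
    case False
    with \<sigma> have "\<sigma> n = 0" by blast
    with min show ?thesis
      using word_Suc(2,3) [OF Suc.prems(3), of n] word_Suc(2,3) [OF Suc.prems(4), of n]
      by (simp flip: x'_def y'_def mult_2)
  qed
qed

section \<open>Translations between classes and bounds on the Kantorovich distance\<close>

definition rho :: "'a \<Rightarrow> 'a \<Rightarrow> real" where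
  "rho x y = config_dist (T x) (T y)"

text \<open>Sends \<open>act g x\<close> to \<open>act g y\<close>: the element \<open>g\<close> is
  recovered from the digits at which the second coordinates of \<open>z\<close> and \<open>x\<close>
  differ.\<close>

definition translate :: "nat \<Rightarrow> 'a \<Rightarrow> 'a \<Rightarrow> 'a \<Rightarrow> 'a" where
  "translate n x y z = act (low n (\<lambda>i. snd (T z) i \<noteq> snd (T x) i)) y"

lemma translate_act: "g < 2 ^ n \<Longrightarrow> translate n x y (act g x) = act g y"
proof -
  have "(\<lambda>i. snd (T (act g x)) i \<noteq> snd (T x) i) = bit g"
    by (auto simp: snd_T_act)
  then show "g < 2 ^ n \<Longrightarrow> ?thesis"
    by (simp add: translate_def low_bit)
qed

text \<open>Translation commutes with the action, hence carries orbits of each \<open>D_j\<close> to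
  orbits. It also shows that \<open>kant\<close> is a minimum over a nonempty set.\<close>

lemma tree_map_translate:
  assumes x: "x \<in> space M" and y: "y \<in> space M"
  shows "tree_map cls n (cls n x) (cls n y) (translate n x y)"
  unfolding tree_map_def
proof (intro conjI allI impI ballI)
  have "translate n x y ` cls n x = cls n y"
    using x y by (auto simp: cls_eq image_image translate_act)
  then show "bij_betw (translate n x y) (cls n x) (cls n y)"
    using x y by (metis bij_betw_def card_cls eq_card_imp_inj_on finite_cls)
next
  fix j z assume "j < n" "z \<in> cls n x"
  then obtain g where g: "z = act g x" "g < 2 ^ n"
    using x by (auto simp: cls_eq)
  have "xor h g < 2 ^ n" if "h < 2 ^ j" for h
  proof -
    have "(2 :: nat) ^ j \<le> 2 ^ n" using \<open>j < n\<close> by simp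
    with that have "h < 2 ^ n" by (rule less_le_trans)
    then show ?thesis using g(2) by (rule xor_less_pow)
  qed
  then show "translate n x y ` cls j z = cls j (translate n x y z)"
    using g by (auto simp: cls_eq act_act translate_act image_image)
qed

lemma kant_ge:
  assumes x: "x \<in> space M" "fst (T x) \<in> periodic \<sigma>" and y: "y \<in> space M" "fst (T y) \<in> periodic \<sigma>"
  shows "real (cost (\<Sum>i<n. \<sigma> i) (word n x) (word n y)) / 2 ^ (\<Sum>i<n. \<sigma> i)
    \<le> kant rho cls n (cls n x) (cls n y)"
proof -
  let ?k = "\<Sum>i<n. \<sigma> i"
  obtain s where s: "tree_map cls n (cls n x) (cls n y) s"
    and kant: "kant rho cls n (cls n x) (cls n y) = (\<Sum>z\<in>cls n x. rho z (s z)) / 2 ^ n"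
    by (rule kant_attained [OF finite_cls [OF x(1)] finite_cls [OF y(1)] tree_map_translate [OF x(1) y(1)]])
  have "real (2 ^ n * cost ?k (word n x) (word n y))
      \<le> real (2 ^ ?k * (\<Sum>z\<in>cls n x. of_bool (fst (T z) 0 \<noteq> fst (T (s z)) 0)))"
    using cost_le_tree_map [OF x(1) y(1) x(2) y(2) s] by (intro of_nat_mono)
  also have "\<dots> = 2 ^ ?k * (\<Sum>z\<in>cls n x. of_bool (fst (T z) 0 \<noteq> fst (T (s z)) 0))"
    by simp
  also have "\<dots> \<le> 2 ^ ?k * (\<Sum>z\<in>cls n x. rho z (s z))"
    unfolding rho_def by (intro mult_left_mono sum_mono config_dist_ge) auto
  finally show ?thesis
    unfolding kant by (simp add: field_simps)
qed

text \<open>A measurable choice of one point in each class, the one whose first \<open>n\<close>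
  digits vanish; its word is an invariant of the class.\<close>

definition normal :: "nat \<Rightarrow> 'a \<Rightarrow> 'a" where
  "normal n x = act (low n (snd (T x))) x"

lemma normal_act:
  assumes "g < 2 ^ n"
  shows "normal n (act g x) = normal n x"
proof -
  have "snd (T (act g x)) = (\<lambda>i. snd (T x) i \<noteq> bit g i)"
    by (auto simp: snd_T_act)
  with assms show ?thesis
    by (simp only: normal_def act_act low_shift)
qed

lemma cls_normal: "x \<in> space M \<Longrightarrow> cls n (normal n x) = cls n x"
  by (simp add: normal_def cls_act low_less)

text \<open>The coset representative of an element of \<open>D_n\<close> lies in \<open>D_n\<close>
  again, so the word determines a periodic configuration on all of \<open>D_n\<close>.\<close>

lemma periodic_word_eqD:
  assumes "w \<in> periodic \<sigma>" "w' \<in> periodic \<sigma>" "map w (reps \<sigma> n) = map w' (reps \<sigma> n)" "g < 2 ^ n"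
  shows "w g = w' g"
proof -
  have "coset_rep \<sigma> g \<in> set (reps \<sigma> n)"
    using assms(4) by (auto simp: set_reps coset_rep_idem less_pow_iff_bit bit_coset_rep)
  then have "w (coset_rep \<sigma> g) = w' (coset_rep \<sigma> g)"
    using assms(3) by simp
  then show ?thesis
    using assms(1,2) unfolding periodic_def mem_Collect_eq by (metis (no_types))
qed

text \<open>Translate one normal point to the other. Matched points carry the same first
  \<open>n\<close> digits, and their configurations agree on \<open>D_n\<close>, so only the tail of
  the metric remains.\<close>

lemma kant_le_of_normal_word_eq:
  assumes x: "x \<in> space M" "fst (T x) \<in> periodic \<sigma>" and y: "y \<in> space M" "fst (T y) \<in> periodic \<sigma>"
    and eq: "word n (normal n x) = word n (normal n y)"
  shows "kant rho cls n (cls n x) (cls n y) \<le> 2 * (1 / 2) ^ n"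
proof -
  define u v where "u = normal n x" and "v = normal n y"
  have uv: "u \<in> space M" "v \<in> space M" and per: "fst (T u) \<in> periodic \<sigma>" "fst (T v) \<in> periodic \<sigma>"
    using x y by (auto simp: u_def v_def normal_def periodic_act)
  have snd0: "\<not> snd (T u) i" "\<not> snd (T v) i" if "i < n" for i
    using that by (auto simp: u_def v_def normal_def snd_T_act bit_low)
  have "rho z (translate n u v z) \<le> 2 * (1 / 2) ^ n" if "z \<in> cls n u" for z
  proof -
    obtain g where g: "z = act g u" "g < 2 ^ n"
      using \<open>z \<in> cls n u\<close> uv by (auto simp: cls_eq)
    show ?thesis
      unfolding rho_def
    proof (rule config_dist_le)
      fix i assume "i < n"
      \<comment> \<open>Here \<open>i\<close> acts as a group element, so it has to lie in
        \<open>D_n\<close> for the equality of words to apply.\<close>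
      then have "i < 2 ^ n"
        using less_exp [of n] by (rule less_trans)
      then have "fst (T u) (xor i g) = fst (T v) (xor i g)"
        using periodic_word_eqD [OF per, of n "xor i g"] eq g(2)
        by (simp add: word_def u_def v_def xor_less_pow)
      then show "\<not> differ (T z) (T (translate n u v z)) i"
        using g \<open>i < n\<close> snd0 by (simp add: differ_def translate_act fst_T_act snd_T_act)
    qed
  qed
  then have "(\<Sum>z\<in>cls n u. rho z (translate n u v z)) \<le> (\<Sum>z\<in>cls n u. 2 * (1 / 2) ^ n)"
    by (rule sum_mono)
  also have "\<dots> = 2 ^ n * (2 * (1 / 2) ^ n)"
    using uv by (simp add: card_cls)
  finally have "(\<Sum>z\<in>cls n u. rho z (translate n u v z)) / 2 ^ n \<le> 2 * (1 / 2) ^ n"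
    by (simp add: divide_le_eq mult.commute)
  moreover have "kant rho cls n (cls n u) (cls n v) \<le> (\<Sum>z\<in>cls n u. rho z (translate n u v z)) / 2 ^ n"
    by (intro kant_le finite_cls tree_map_translate uv)
  ultimately show ?thesis
    using x y by (simp add: u_def v_def cls_normal)
qed

section \<open>Transport of the measure and admissibility of the metric\<close>

lemma emeasure_T:
  assumes "A \<in> sets (omega \<sigma>)"
  shows "emeasure M {x \<in> space M. T x \<in> A} = emeasure (omega \<sigma>) A"
proof -
  have "emeasure (omega \<sigma>) A = emeasure (distr M (omega \<sigma>) T) A"
    by (simp only: distr_T)
  also have "\<dots> = emeasure M (T -` A \<inter> space M)"
    using assms by (intro emeasure_distr) simp_all
  also have "T -` A \<inter> space M = {x \<in> space M. T x \<in> A}"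
    by auto
  finally show ?thesis by simp
qed

lemma prob_space_M: "prob_space M"
  using emeasure_T [of UNIV] prob_space.emeasure_space_1 [OF prob_space_omega, of \<sigma>]
    sets.top [of "omega \<sigma>"]
  by (intro prob_spaceI) (simp add: space_omega)

lemma summable_admissible_rho: "summable_admissible_metric M rho"
proof -
  interpret prob_space M by (rule prob_space_M)
  interpret pair_prob_space M M ..
  have "(\<lambda>z. (T (fst z), T (snd z))) \<in> measurable (M \<Otimes>\<^sub>M M) (omega \<sigma> \<Otimes>\<^sub>M omega \<sigma>)"
    by measurable
  from measurable_compose [OF this measurable_config_dist]
  have meas: "case_prod rho \<in> borel_measurable (M \<Otimes>\<^sub>M M)"
    by (simp add: rho_def case_prod_beta')
  have int: "integrable (M \<Otimes>\<^sub>M M) (case_prod rho)"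
  proof (rule P.integrable_const_bound [OF _ meas])
    show "AE z in M \<Otimes>\<^sub>M M. norm (case_prod rho z) \<le> 2"
      using config_dist_le [of 0] by (intro AE_I2) (auto simp: rho_def config_dist_ge_0 split: prod.split)
  qed
  have sep: "\<exists>S. countable S \<and> S \<subseteq> space M \<and> (\<forall>x\<in>space M. \<forall>e>0. \<exists>s\<in>S. rho x s < e)"
  proof (intro exI conjI ballI allI impI)
    let ?D = "range (\<lambda>(a :: nat, b :: nat). (bit a, bit b))"
    let ?S = "the_inv_into (space M) T ` ?D"
    show "countable ?S" by simp
    show "?S \<subseteq> space M"
      using bij by (auto simp: bij_betw_def intro!: the_inv_into_into)
    fix x :: 'a and e :: real assume "0 < e"
    then obtain d where "d \<in> ?D" "config_dist (T x) d < e"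
      using config_dist_dense by blast
    moreover have "T (the_inv_into (space M) T d) = d"
      using bij by (intro f_the_inv_into_f_bij_betw) auto
    ultimately have "rho x (the_inv_into (space M) T d) < e"
      by (simp only: rho_def)
    with \<open>d \<in> ?D\<close> show "\<exists>s\<in>?S. rho x s < e"
      by blast
  qed
  have eq_0: "rho x y = 0 \<longleftrightarrow> x = y" if "x \<in> space M" "y \<in> space M" for x y
    using that T_eqD by (auto simp: rho_def config_dist_eq_0_iff)
  have sym: "rho x y = rho y x" and tri: "rho x z \<le> rho x y + rho y z" for x y z
    unfolding rho_def by (rule config_dist_sym config_dist_triangle)+
  show ?thesis
    unfolding summable_admissible_metric_def
    by (intro conjI exI [of _ "space M"] ballI eq_0 sym tri sep meas int) simp_all
qed

section \<open>The exceptional null set and the two entropy bounds\<close>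

lemma emeasure_not_periodic_T: "emeasure M {x \<in> space M. fst (T x) \<notin> periodic \<sigma>} = 0"
  and sets_not_periodic_T: "{x \<in> space M. fst (T x) \<notin> periodic \<sigma>} \<in> sets M"
proof -
  have "- periodic \<sigma> \<in> sets bern"
    using sets.compl_sets [OF periodic_sets [of \<sigma>]] by (simp add: space_bern Compl_eq_Diff_UNIV)
  then have "emeasure (omega \<sigma>) {p. fst p \<in> - periodic \<sigma>} = 0"
    by (simp only: emeasure_omega_fst emeasure_not_periodic)
  moreover have A: "{p. fst p \<in> - periodic \<sigma>} \<in> sets (omega \<sigma>)"
  proof -
    have "fst -` (- periodic \<sigma>) \<inter> space (omega \<sigma>) \<in> sets (omega \<sigma>)"
      using \<open>- periodic \<sigma> \<in> sets bern\<close> by (intro measurable_sets [of _ _ bern]) measurable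
    then show ?thesis by (simp add: vimage_def space_omega)
  qed
  ultimately show "emeasure M {x \<in> space M. fst (T x) \<notin> periodic \<sigma>} = 0"
    using emeasure_T [OF A] by simp
  show "{x \<in> space M. fst (T x) \<notin> periodic \<sigma>} \<in> sets M"
    using measurable_sets [OF measurable_T A] by (simp add: vimage_def Int_def conj_commute)
qed

text \<open>Around one periodic point of the set, all other periodic points of it have words in a
  small cost ball. Dividing the size of the ball by the number of words turns \<open>19 / 10\<close>
  into \<open>19 / 20\<close>; the remaining points are null.\<close>

lemma emeasure_small_diam:
  assumes A: "A \<in> sets M" and "\<epsilon> < 1 / 100"
    and diam: "\<And>x y. x \<in> A \<Longrightarrow> y \<in> A \<Longrightarrow> kant rho cls n (cls n x) (cls n y) < \<epsilon>"
  shows "emeasure M A \<le> ennreal ((19 / 20) ^ 2 ^ (\<Sum>i<n. \<sigma> i))"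
proof (cases "\<exists>x\<in>A. fst (T x) \<in> periodic \<sigma>")
  case False
  then have "emeasure M A \<le> emeasure M {x \<in> space M. fst (T x) \<notin> periodic \<sigma>}"
    using sets.sets_into_space [OF A] by (intro emeasure_mono sets_not_periodic_T) auto
  then show ?thesis
    by (simp add: emeasure_not_periodic_T)
next
  case True
  then obtain x where x: "x \<in> A" "x \<in> space M" "fst (T x) \<in> periodic \<sigma>"
    using sets.sets_into_space [OF A] by auto
  let ?s = "\<Sum>i<n. \<sigma> i"
  define B where "B = {l' \<in> words (2 ^ ?s). real (cost ?s (word n x) l') < \<epsilon> * 2 ^ ?s}"
  let ?W = "{y \<in> space M. T y \<in> {p. map (fst p) (reps \<sigma> n) \<in> B}}"
  have W: "{p. map (fst p) (reps \<sigma> n) \<in> B} \<in> sets (omega \<sigma>)"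
    using measurable_sets [OF measurable_word [of "reps \<sigma> n" \<sigma>], of B]
    by (simp add: vimage_def space_omega)
  have sub: "A \<subseteq> {y \<in> space M. fst (T y) \<notin> periodic \<sigma>} \<union> ?W"
  proof
    fix y assume y: "y \<in> A"
    then have "y \<in> space M" using sets.sets_into_space [OF A] by auto
    moreover have "word n y \<in> B" if "fst (T y) \<in> periodic \<sigma>"
    proof -
      have "real (cost ?s (word n x) (word n y)) / 2 ^ ?s < \<epsilon>"
        using kant_ge [of x y n] diam [OF x(1) y] x that \<open>y \<in> space M\<close> by auto
      then show ?thesis
        by (simp add: B_def word_in_words divide_less_eq)
    qed
    ultimately show "y \<in> {y \<in> space M. fst (T y) \<notin> periodic \<sigma>} \<union> ?W"
      by (auto simp: word_def)
  qed
  have WM: "?W \<in> sets M"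
    using measurable_sets [OF measurable_T W] by (simp add: vimage_def Int_def conj_commute)
  have "emeasure M A \<le> emeasure M ({y \<in> space M. fst (T y) \<notin> periodic \<sigma>} \<union> ?W)"
    by (intro emeasure_mono sub sets.Un sets_not_periodic_T WM)
  also have "\<dots> \<le> emeasure M {y \<in> space M. fst (T y) \<notin> periodic \<sigma>} + emeasure M ?W"
    by (intro emeasure_subadditive sets_not_periodic_T WM)
  also have "\<dots> = emeasure (omega \<sigma>) {p. map (fst p) (reps \<sigma> n) \<in> B}"
    by (simp only: emeasure_not_periodic_T emeasure_T [OF W] add_0)
  also have "\<dots> \<le> ennreal (real (card B) / 2 ^ 2 ^ ?s)"
    using emeasure_omega_words_le [of B \<sigma> n] by (auto simp: B_def length_reps [OF \<sigma>])
  also have "\<dots> \<le> ennreal ((19 / 10) ^ 2 ^ ?s / 2 ^ 2 ^ ?s)"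
    unfolding B_def
    by (intro ennreal_leI divide_right_mono card_cost_ball_le word_in_words assms(2)) auto
  also have "(19 / 10) ^ 2 ^ ?s / 2 ^ 2 ^ ?s = (19 / 20 :: real) ^ 2 ^ ?s"
    by (simp flip: power_divide)
  finally show ?thesis .
qed

text \<open>The pieces must cover total mass 1, and each of the \<open>k\<close> pieces of small
  diameter has mass at most \<open>(19 / 20) ^ ?m\<close>. The constant is
  \<open>99 / 95 = (99 / 100) / (19 / 20)\<close>.\<close>

lemma eps_partition_lower:
  assumes Y: "eps_partition \<epsilon> (quot_measure M (cls n)) (kant rho cls n) k Y"
    and \<epsilon>: "0 < \<epsilon>" "\<epsilon> < 1 / 100"
  shows "log 2 (99 / 95) * 2 ^ (\<Sum>i<n. \<sigma> i) \<le> log 2 (real k)"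
proof -
  interpret prob_space M by (rule prob_space_M)
  let ?N = "quot_measure M (cls n)" and ?m = "2 ^ (\<Sum>i<n. \<sigma> i) :: nat"
  have YN: "Y j \<in> sets ?N" if "j \<le> k" for j
    using Y that by (simp add: eps_partition_def)
  have small: "emeasure ?N (Y j) \<le> ennreal ((19 / 20) ^ ?m)" if "j \<in> {1..k}" for j
  proof -
    have "(SUP p\<in>Y j \<times> Y j. ereal (kant rho cls n (fst p) (snd p))) < ereal \<epsilon>"
      using Y that by (simp add: eps_partition_def)
    then have "kant rho cls n c c' < \<epsilon>" if "c \<in> Y j" "c' \<in> Y j" for c c'
      using SUP_lessD [of _ "Y j \<times> Y j" "ereal \<epsilon>" "(c, c')"] that by fastforce
    then show ?thesis
      using YN [of j] that \<epsilon>(2)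
      by (subst emeasure_quot_measure)
        (auto simp: sets_quot_measure intro!: emeasure_small_diam)
  qed
  have "1 = emeasure ?N (space ?N)"
  proof -
    have "cls n -` cls n ` space M \<inter> space M = space M" by auto
    then show ?thesis
      using emeasure_quot_measure [OF sets.top, of M "cls n"] emeasure_space_1
      by (simp add: space_quot_measure)
  qed
  also have "\<dots> = emeasure ?N (\<Union>j\<le>k. Y j)"
    using Y by (simp add: eps_partition_def)
  also have "\<dots> \<le> (\<Sum>j\<le>k. emeasure ?N (Y j))"
    using YN by (intro emeasure_subadditive_finite) auto
  also have "\<dots> = emeasure ?N (Y 0) + (\<Sum>j\<in>{1..k}. emeasure ?N (Y j))"
    by (simp add: sum.atMost_shift sum.atLeast1_atMost_eq lessThan_Suc_atMost)
  also have "\<dots> \<le> ennreal \<epsilon> + (\<Sum>j\<in>{1..k}. ennreal ((19 / 20) ^ ?m))"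
    using Y by (intro add_mono sum_mono small) (auto simp: eps_partition_def)
  also have "\<dots> = ennreal (\<epsilon> + real k * (19 / 20) ^ ?m)"
    using \<epsilon> by (simp add: ennreal_of_nat_eq_real_of_nat flip: ennreal_mult ennreal_plus)
  finally have "ennreal 1 \<le> ennreal (\<epsilon> + real k * (19 / 20) ^ ?m)"
    by simp
  then have "1 \<le> \<epsilon> + real k * (19 / 20) ^ ?m"
    using \<epsilon> by (subst (asm) ennreal_le_iff) (auto intro!: add_nonneg_nonneg)
  then have "99 / 100 \<le> real k * (19 / 20) ^ ?m"
    using \<epsilon> by linarith
  \<comment> \<open>Replacing the constant by its \<open>?m\<close>-th power lets the bound hold for
    every \<open>n\<close>, with one base greater than 1.\<close>
  moreover have "(99 / 100 :: real) ^ ?m \<le> 99 / 100"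
    using power_decreasing [of 1 ?m "99 / 100 :: real"] by simp
  ultimately have "(99 / 100) ^ ?m \<le> real k * (19 / 20) ^ ?m"
    by linarith
  then have "(99 / 100) ^ ?m / (19 / 20) ^ ?m \<le> real k"
    by (simp add: divide_le_eq)
  then have "(99 / 95) ^ ?m \<le> real k"
    by (simp flip: power_divide)
  then have "log 2 ((99 / 95) ^ ?m) \<le> log 2 (real k)"
    by (intro log_mono) auto
  then show ?thesis
    by (simp add: log_nat_power mult.commute)
qed

text \<open>A condition invariant under \<open>D_n\<close> is a condition on classes, so its set of
  classes pulls back to the set itself.\<close>

lemma cls_in_image_iff:
  assumes inv: "\<And>x g. x \<in> space M \<Longrightarrow> g < 2 ^ n \<Longrightarrow> Q x \<Longrightarrow> Q (act g x)"
  shows "y \<in> space M \<Longrightarrow> cls n y \<in> cls n ` {x \<in> space M. Q x} \<longleftrightarrow> Q y"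
proof
  assume y: "y \<in> space M" and "cls n y \<in> cls n ` {x \<in> space M. Q x}"
  then obtain x where "x \<in> space M" "Q x" "y \<in> cls n x"
    using self_in_cls [OF y] by auto
  then show "Q y"
    using inv by (auto simp: cls_eq)
qed auto

text \<open>Classes of non-periodic points form the null exceptional set; the others are sorted by
  the word of their normal point, and equal words mean small distance.\<close>

lemma eps_partition_upper:
  assumes "0 < \<epsilon>" "2 * (1 / 2) ^ n < \<epsilon>"
  shows "\<exists>Y. eps_partition \<epsilon> (quot_measure M (cls n)) (kant rho cls n) (2 ^ 2 ^ (\<Sum>i<n. \<sigma> i)) Y"
proof -
  let ?m = "2 ^ (\<Sum>i<n. \<sigma> i) :: nat"
  let ?k = "2 ^ ?m :: nat"
  \<comment> \<open>Words are numbered from 1, as index 0 is taken by the exceptional set.\<close>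
  obtain e where e: "bij_betw e {1..?k} (words ?m)"
    using ex_bij_betw_nat_finite_1 [OF finite_words, of ?m] by (auto simp: card_words)
  define Q where "Q j x \<longleftrightarrow> (if j = 0 then fst (T x) \<notin> periodic \<sigma>
    else fst (T x) \<in> periodic \<sigma> \<and> word n (normal n x) = e j)" for j x
  define Y where "Y j = cls n ` {x \<in> space M. Q j x}" for j
  have per_iff: "fst (T (act g x)) \<in> periodic \<sigma> \<longleftrightarrow> fst (T x) \<in> periodic \<sigma>" if "x \<in> space M" for g x
    using periodic_act [of x g] periodic_act [of "act g x" g] that by (auto simp: act_act act_0)
  have Q: "Q j (act g x)" if "x \<in> space M" "g < 2 ^ n" "Q j x" for j g x
    using that by (auto simp: Q_def per_iff normal_act)
  have in_Y: "cls n x \<in> Y j \<longleftrightarrow> Q j x" if "x \<in> space M" for x j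
    unfolding Y_def using cls_in_image_iff [of n "Q j"] Q that by blast
  then have vimage: "cls n -` Y j \<inter> space M = {x \<in> space M. Q j x}" for j
    by auto
  have Y_sub: "Y j \<subseteq> cls n ` space M" for j
    by (auto simp: Y_def)
  have "{x \<in> space M. Q j x} \<in> sets M" for j
  proof -
    have eq: "word n (normal n x) = map (\<lambda>h. fst (T x) (xor h (low n (snd (T x))))) (reps \<sigma> n)" for x
      by (simp add: word_def normal_def fst_T_act)
    have "(\<lambda>x. word n (normal n x)) \<in> measurable M (count_space UNIV)"
      unfolding eq by (rule measurable_compose [OF measurable_T measurable_shifted_word])
    then have w: "{x \<in> space M. word n (normal n x) = e j} \<in> sets M"
      by measurable
    have "{x \<in> space M. Q j x} = (if j = 0 then {x \<in> space M. fst (T x) \<notin> periodic \<sigma>}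
      else {x \<in> space M. word n (normal n x) = e j} - {x \<in> space M. fst (T x) \<notin> periodic \<sigma>})"
      by (auto simp: Q_def)
    then show ?thesis
      using w sets_not_periodic_T by simp
  qed
  then have sets: "Y j \<in> sets (quot_measure M (cls n))" for j
    using vimage Y_sub by (simp add: sets_quot_measure)
  show ?thesis
  proof (intro exI [of _ Y], unfold eps_partition_def, intro conjI ballI allI impI sets)
    show "(\<Union>j\<le>?k. Y j) = space (quot_measure M (cls n))"
    proof -
      have "\<exists>j\<le>?k. Q j x" for x
      proof (cases "fst (T x) \<in> periodic \<sigma>")
        case True
        have "word n (normal n x) \<in> e ` {1..?k}"
          using e word_in_words [of n] by (simp add: bij_betw_def)
        then obtain j where "j \<in> {1..?k}" "word n (normal n x) = e j" by blast
        with True show ?thesis by (intro exI [of _ j]) (simp add: Q_def)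
      qed (simp add: Q_def exI [of _ 0])
      then have "cls n x \<in> (\<Union>j\<le>?k. Y j)" if "x \<in> space M" for x
        using in_Y [OF that] by blast
      then show ?thesis
        using Y_sub unfolding space_quot_measure by blast
    qed
    show "disjoint_family_on Y {..?k}"
    proof (unfold disjoint_family_on_def, intro ballI impI)
      fix i j assume ij: "i \<in> {..?k}" "j \<in> {..?k}" "i \<noteq> j"
      have False if "Q i x" "Q j x" for x
      proof -
        from that have "i \<noteq> 0" "j \<noteq> 0" "e i = e j"
          using ij by (auto simp: Q_def split: if_splits)
        then show False
          using ij inj_onD [OF bij_betw_imp_inj_on [OF e], of i j] by auto
      qed
      then show "Y i \<inter> Y j = {}"
        using Y_sub [of i] in_Y by blast
    qed
    have "emeasure (quot_measure M (cls n)) (Y 0) = 0"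
      by (simp only: emeasure_quot_measure [OF sets] vimage)
        (simp add: Q_def emeasure_not_periodic_T)
    then show "emeasure (quot_measure M (cls n)) (Y 0) < ennreal \<epsilon>"
      using assms(1) by simp
    fix j assume "j \<in> {1..?k}"
    then have "kant rho cls n c c' \<le> 2 * (1 / 2) ^ n" if "c \<in> Y j" "c' \<in> Y j" for c c'
      using that by (auto simp: Y_def Q_def intro!: kant_le_of_normal_word_eq)
    then have "(SUP p\<in>Y j \<times> Y j. ereal (kant rho cls n (fst p) (snd p))) \<le> ereal (2 * (1 / 2) ^ n)"
      by (intro SUP_least) auto
    also have "\<dots> < ereal \<epsilon>"
      using assms(2) by simp
    finally show "(SUP p\<in>Y j \<times> Y j. ereal (kant rho cls n (fst p) (snd p))) < ereal \<epsilon>" .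
  qed
qed

lemma scaling_sequence_cls: "scaling_sequence M cls (\<lambda>n. 2 ^ (\<Sum>i<n. \<sigma> i))"
  unfolding scaling_sequence_def
proof (intro conjI exI [of _ rho] exI [of _ "1 / 100"] allI impI summable_admissible_rho)
  fix \<epsilon> :: real assume \<epsilon>: "0 < \<epsilon> \<and> \<epsilon> < 1 / 100"
  let ?a = "\<lambda>n. eps_entropy \<epsilon> (quot_measure M (cls n)) (kant rho cls n)"
  show "weak_equiv ?a (\<lambda>n. ereal (2 ^ (\<Sum>i<n. \<sigma> i)))"
  proof (rule weak_equivI)
    show "0 < log 2 (99 / 95 :: real)" by simp
    show "ereal (log 2 (99 / 95) * 2 ^ (\<Sum>i<n. \<sigma> i)) \<le> ?a n" for n
      using eps_partition_lower \<epsilon> by (intro eps_entropy_ge) auto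
    \<comment> \<open>The upper bound starts only once the truncation error of the metric is below
      \<open>\<epsilon>\<close>.\<close>
    have "(\<lambda>n. 2 * (1 / 2 :: real) ^ n) \<longlonglongrightarrow> 2 * 0"
      by (intro tendsto_mult tendsto_const LIMSEQ_power_zero) simp
    then have "\<forall>\<^sub>F n in sequentially. 2 * (1 / 2) ^ n < \<epsilon>"
      using \<epsilon> by (intro order_tendstoD(2)) auto
    then show "\<forall>\<^sub>F n in sequentially. ?a n \<le> ereal (2 ^ (\<Sum>i<n. \<sigma> i))"
    proof eventually_elim
      case (elim n)
      then obtain Y where "eps_partition \<epsilon> (quot_measure M (cls n)) (kant rho cls n)
          (2 ^ 2 ^ (\<Sum>i<n. \<sigma> i)) Y"
        using eps_partition_upper \<epsilon> by blast
      from eps_entropy_le [OF this] show ?case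
        by (simp add: log_nat_power)
    qed
  qed simp
qed simp_all

end

section \<open>The graph of ordered pairs\<close>

text \<open>Connects offsets in the list encoding of vertices with the group law.\<close>

lemma add_pow_eq_xor:
  fixes a :: nat
  assumes "a < 2 ^ n"
  shows "a + 2 ^ n = xor a (2 ^ n)"
  using assms bit_less_pow [of a n n]
  by (intro disjunctive_add_eq_xor bit_eqI) (auto simp: bit_and_iff bit_exp_iff)

text \<open>The inverse of \<open>Psi\<close>: the floor-\<open>n\<close> vertex is the
  configuration on \<open>D_n\<close> translated by the first \<open>n\<close> edge indices.\<close>

definition path_of :: "(nat \<Rightarrow> bool) \<times> (nat \<Rightarrow> bool) \<Rightarrow> op_path" where
  "path_of p n = (map (\<lambda>h. fst p (xor h (low n (snd p)))) [0..<2 ^ n], snd p n)"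

lemma path_of_in_op_paths: "path_of p \<in> op_paths"
proof -
  have "fst (path_of p n) = (if snd (path_of p n) then drop (2 ^ n) (fst (path_of p (Suc n)))
      else take (2 ^ n) (fst (path_of p (Suc n))))" for n
  proof (rule nth_equalityI)
    fix h assume "h < length (fst (path_of p n))"
    then have h: "h < 2 ^ n" by (simp add: path_of_def)
    \<comment> \<open>An index-1 edge sets the top bit both in the list position and in the
      translation; the two cancel.\<close>
    have "xor (h + 2 ^ n) (low n (snd p) + 2 ^ n) = xor h (low n (snd p))"
      using h by (simp add: add_pow_eq_xor low_less) (simp add: ac_simps)
    then show "fst (path_of p n) ! h = (if snd (path_of p n) then drop (2 ^ n) (fst (path_of p (Suc n)))
        else take (2 ^ n) (fst (path_of p (Suc n)))) ! h"
      using h by (auto simp: path_of_def low_Suc add.commute)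
  qed (auto simp: path_of_def)
  then show ?thesis
    by (auto simp: op_paths_def path_of_def)
qed

lemma snd_Psi: "snd (Psi x) = (\<lambda>k. snd (x k))"
  by (simp add: Psi_def)

text \<open>\<open>Psi\<close> evaluates at floor \<open>g\<close>. Passing to the next floor moves
  the vertex label and the translation together, so every floor \<open>n\<close> with
  \<open>g < 2 ^ n\<close> gives the same value.\<close>

lemma fst_Psi:
  assumes x: "x \<in> op_paths" and g: "g < 2 ^ n"
  shows "fst (Psi x) g = fst (x n) ! xor g (low n (snd (Psi x)))"
proof -
  let ?\<alpha> = "snd (Psi x)"
  define V where "V n = fst (x n) ! xor g (low n ?\<alpha>)" for n
  have len: "length (fst (x n)) = 2 ^ n"
    and step: "fst (x n) = (if ?\<alpha> n then drop (2 ^ n) (fst (x (Suc n)))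
                   else take (2 ^ n) (fst (x (Suc n))))" for n
    using x unfolding op_paths_def snd_Psi by blast+
  have V_Suc: "V (Suc n) = V n" if g: "g < 2 ^ n" for n
  proof -
    have less: "xor g (low n ?\<alpha>) < 2 ^ n"
      using g low_less by (rule xor_less_pow)
    have "xor g (low n ?\<alpha> + 2 ^ n) = 2 ^ n + xor g (low n ?\<alpha>)"
      using add_pow_eq_xor [OF less] add_pow_eq_xor [OF low_less [of n ?\<alpha>]] by (simp add: ac_simps)
    with less show ?thesis
      unfolding V_def low_Suc by (subst (2) step) (simp add: len)
  qed
  have mono: "V m = V k" if "k \<le> m" "g < 2 ^ k" for k m
    using that(1)
  proof (induction m rule: dec_induct)
    case (step m)
    have "(2 :: nat) ^ k \<le> 2 ^ m" using step(1) by simp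
    with that(2) have "g < 2 ^ m" by (rule less_le_trans)
    then show ?case using step V_Suc by simp
  qed simp
  have "V g = V n"
    using mono [of g n] mono [of n g] g less_exp [of g] by (cases "g \<le> n") auto
  then show ?thesis
    by (simp add: V_def Psi_def Phi_def low_def)
qed

lemma Psi_path_of: "Psi (path_of p) = p"
proof (rule prod_eqI)
  show 1: "snd (Psi (path_of p)) = snd p"
    by (simp add: snd_Psi path_of_def)
  show "fst (Psi (path_of p)) = fst p"
  proof
    fix g :: nat
    have "xor g (low g (snd p)) < 2 ^ g"
      using less_exp low_less by (rule xor_less_pow)
    then show "fst (Psi (path_of p)) g = fst p g"
      unfolding fst_Psi [OF path_of_in_op_paths less_exp] 1
      by (simp add: path_of_def xor_cancel)
  qed
qed

lemma path_of_Psi: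
  assumes "x \<in> op_paths"
  shows "path_of (Psi x) = x"
proof
  fix n
  have len: "length (fst (x n)) = 2 ^ n"
    using assms unfolding op_paths_def by blast
  have "fst (path_of (Psi x) n) = fst (x n)"
  proof (rule nth_equalityI)
    fix h assume "h < length (fst (path_of (Psi x) n))"
    then have h: "h < 2 ^ n" by (simp add: path_of_def)
    then have "xor h (low n (snd (Psi x))) < 2 ^ n"
      using low_less by (rule xor_less_pow)
    with h show "fst (path_of (Psi x) n) ! h = fst (x n) ! h"
      by (simp add: path_of_def fst_Psi [OF assms] xor_cancel)
  qed (simp add: path_of_def len)
  then show "path_of (Psi x) n = x n"
    by (intro prod_eqI) (auto simp: path_of_def snd_Psi)
qed

lemma bij_betw_Psi: "bij_betw Psi op_paths UNIV"
  by (rule bij_betw_byWitness [where f' = path_of])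
    (auto simp: Psi_path_of path_of_Psi path_of_in_op_paths)

lemma inv_into_Psi: "inv_into op_paths Psi = path_of"
proof
  show "inv_into op_paths Psi p = path_of p" for p
    using bij_betw_Psi path_of_in_op_paths Psi_path_of
    by (intro inv_into_f_eq) (auto simp: bij_betw_def)
qed

text \<open>Paths that agree from floor \<open>n\<close> on differ by an element of
  \<open>D_n\<close>, namely by the difference of their first \<open>n\<close> edge indices.\<close>

lemma xi_eq:
  assumes x: "x \<in> op_paths"
  shows "xi n x = {y \<in> op_paths. Psi y \<in> zeta n (Psi x)}"
proof -
  have "(\<forall>k\<ge>n. y k = x k) \<longleftrightarrow> Psi y \<in> zeta n (Psi x)" if y: "y \<in> op_paths" for y
  proof
    assume eq: "\<forall>k\<ge>n. y k = x k"
    define g where "g = xor (low n (snd (Psi x))) (low n (snd (Psi y)))"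
    have g: "g < 2 ^ n"
      unfolding g_def by (intro xor_less_pow low_less)
    have snd_eq: "snd (Psi y) k = snd (Psi x) k" if "n \<le> k" for k
      using eq that by (simp add: snd_Psi)
    then have bit_g: "bit g k \<longleftrightarrow> snd (Psi x) k \<noteq> snd (Psi y) k" for k
      by (cases "k < n") (auto simp: g_def bit_xor_iff bit_low)
    have "fst (Psi y) h = fst (Psi x) (xor h g)" for h
    proof -
      \<comment> \<open>This floor lies in the common part of both paths and is high enough to
        contain both \<open>h\<close> and \<open>g\<close>.\<close>
      define k where "k = n + h"
      have "h < 2 ^ h" by (rule less_exp)
      also have "(2 :: nat) ^ h \<le> 2 ^ k" by (simp add: k_def)
      finally have h: "h < 2 ^ k" .
      have "(2 :: nat) ^ n \<le> 2 ^ k" by (simp add: k_def)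
      with g have "g < 2 ^ k" by (rule less_le_trans)
      with h have hg: "xor h g < 2 ^ k" by (rule xor_less_pow)
      have "xor g (low k (snd (Psi x))) = low k (snd (Psi y))"
        using \<open>g < 2 ^ k\<close> by (intro bit_eqI) (auto simp: bit_xor_iff bit_low bit_g dest: bit_less_pow)
      then show ?thesis
        unfolding fst_Psi [OF y h] fst_Psi [OF x hg] using eq by (simp add: k_def xor.assoc)
    qed
    then have "Psi y = diag g (Psi x)"
      by (intro prod_eqI) (auto simp: diag_def tau_def bit_g)
    with g show "Psi y \<in> zeta n (Psi x)"
      by (auto simp: zeta_def)
  next
    assume "Psi y \<in> zeta n (Psi x)"
    then obtain g where g: "Psi y = diag g (Psi x)" "g < 2 ^ n"
      by (auto simp: zeta_def)
    show "\<forall>k\<ge>n. y k = x k"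
    proof (intro allI impI)
      fix k assume "n \<le> k"
      then have "(2 :: nat) ^ n \<le> 2 ^ k" by simp
      with g(2) have gk: "g < 2 ^ k" by (rule less_le_trans)
      \<comment> \<open>The translation by \<open>g\<close> and the change of the digits below
        \<open>k\<close> cancel, so the floor-\<open>k\<close> vertices agree; bit \<open>k\<close>
        of \<open>g\<close> is clear, so the edges agree too.\<close>
      have "xor h (low k (snd (Psi x))) = xor (xor h (low k (\<lambda>i. snd (Psi x) i \<noteq> bit g i))) g" for h
        using low_shift [OF gk, of "snd (Psi x)"] by (simp only: xor.assoc)
      moreover have "\<not> bit g k"
        using bit_less_pow [OF gk] by blast
      ultimately have "path_of (diag g (Psi x)) k = path_of (Psi x) k"
        by (simp only: path_of_def diag_def tau_def fst_conv snd_conv simp_thms)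
      then show "y k = x k"
        by (simp only: path_of_Psi [OF x] path_of_Psi [OF y] flip: g(1))
    qed
  qed
  then show ?thesis
    by (auto simp: xi_def)
qed

section \<open>Measurability of \<open>Psi\<close> and its inverse\<close>

lemma space_op_space: "space op_space = op_paths"
  by (simp add: op_space_def space_restrict_space space_PiM)

lemma measurable_op_space_component:
  "(\<lambda>x. x n) \<in> measurable op_space (count_space UNIV)"
  unfolding op_space_def
  by (intro measurable_restrict_space1 measurable_component_singleton) simp

lemma measurable_Psi: "Psi \<in> measurable op_space (omega \<sigma>)"
proof -
  have snd [measurable]: "(\<lambda>x. snd (x i)) \<in> measurable op_space (count_space UNIV)" for i
    using measurable_compose [OF measurable_op_space_component, of snd] by simp
  have low: "(\<lambda>x. low n (\<lambda>i. snd (x i))) \<in> measurable op_space (count_space UNIV)" for n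
  proof (induction n)
    case (Suc n)
    note [measurable] = Suc
    show ?case unfolding low_Suc by measurable
  qed (simp add: low_def)
  have "(\<lambda>x. fst (x g) ! xor g (low g (\<lambda>i. snd (x i)))) \<in> measurable op_space (count_space UNIV)" for g
  proof (rule measurable_compose_countable [OF _ low])
    show "(\<lambda>x. fst (x g) ! i) \<in> measurable op_space (count_space UNIV)" for i
      using measurable_compose [OF measurable_op_space_component, of "\<lambda>v. fst v ! i"] by simp
  qed
  then have "(\<lambda>x. fst (Psi x)) \<in> measurable op_space bern"
    by (intro measurable_into_bern) (simp add: Psi_def Phi_def low_def)
  moreover have "(\<lambda>x. snd (Psi x)) \<in> measurable op_space bern"
    unfolding snd_Psi by (intro measurable_into_bern snd)
  ultimately have "(\<lambda>x. (fst (Psi x), snd (Psi x))) \<in> measurable op_space (bern \<Otimes>\<^sub>M bern)"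
    by measurable
  then show ?thesis
    by (simp add: measurable_cong_sets [OF refl sets_omega])
qed

lemma measurable_path_of: "path_of \<in> measurable (omega \<sigma>) op_space"
  unfolding op_space_def
proof (rule measurable_restrict_space2)
  show "path_of \<in> space (omega \<sigma>) \<rightarrow> op_paths"
    by (simp add: path_of_in_op_paths)
  have "(\<lambda>p. path_of p n) \<in> measurable (omega \<sigma>) (count_space UNIV)" for n
  proof -
    have "(\<lambda>p. (map (\<lambda>h. fst p (xor h (low n (snd p)))) [0..<2 ^ n], snd p n))
        \<in> measurable (omega \<sigma>) (count_space UNIV \<Otimes>\<^sub>M count_space UNIV)"
      by (intro measurable_Pair measurable_shifted_word) measurable
    then show ?thesis
      by (simp add: path_of_def pair_measure_countable)
  qed
  then show "path_of \<in> measurable (omega \<sigma>) (PiM UNIV (\<lambda>_. count_space UNIV))"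
    by (intro measurable_PiM_single') auto
qed

theorem theorem9:
  fixes \<sigma> :: "nat \<Rightarrow> nat"
  assumes "\<forall>i. \<sigma> i \<in> {0, 1}"
  shows "scaling_sequence (omega \<sigma>) zeta (\<lambda>n. 2 ^ (\<Sum>i<n. \<sigma> i))
       \<and> scaling_sequence (mu \<sigma>) xi (\<lambda>n. 2 ^ (\<Sum>i<n. \<sigma> i))"
proof
  have "config_filtration \<sigma> (omega \<sigma>) (\<lambda>p. p) zeta"
    using assms by unfold_locales (auto simp: space_omega bij_betw_def distr_id2)
  then show "scaling_sequence (omega \<sigma>) zeta (\<lambda>n. 2 ^ (\<Sum>i<n. \<sigma> i))"
    by (rule config_filtration.scaling_sequence_cls)
  have mu: "mu \<sigma> = distr (omega \<sigma>) op_space path_of"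
    by (simp add: mu_def inv_into_Psi)
  \<comment> \<open>As \<open>mu\<close> is the image of \<open>omega\<close> under the inverse of
    \<open>Psi\<close>, pushing it forward by \<open>Psi\<close> returns
    \<open>omega\<close>.\<close>
  have "distr (mu \<sigma>) (omega \<sigma>) Psi = distr (omega \<sigma>) (omega \<sigma>) (Psi \<circ> path_of)"
    unfolding mu by (rule distr_distr [OF measurable_Psi measurable_path_of])
  also have "Psi \<circ> path_of = (\<lambda>p. p)"
    by (auto simp: Psi_path_of)
  finally have "distr (mu \<sigma>) (omega \<sigma>) Psi = omega \<sigma>"
    by (simp add: distr_id2)
  then have "config_filtration \<sigma> (mu \<sigma>) Psi xi"
    using assms bij_betw_Psi measurable_Psi
    by unfold_locales (simp_all add: mu space_op_space xi_eq)
  then show "scaling_sequence (mu \<sigma>) xi (\<lambda>n. 2 ^ (\<Sum>i<n. \<sigma> i))"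
    by (rule config_filtration.scaling_sequence_cls)
qed

end
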